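(* Let $\Phi$ be a generalized, almost c.p.s. structure on $M$ with classical tensor fields $A,\pi,\sigma$. If the $2$-form $\sigma$ is symplectic, then $\Phi$ is integrable iff the pair $(A,\sigma)$ is a symplectic-Nijenhuis structure.
   Context: All objects are $C^\infty$. $\Gamma$ denotes spaces of sections, $\chi^2(M)$ bivector fields. $T^{big}M=TM\oplus T^*M$ carries the metric $g((X,\alpha),(Y,\beta))=\frac12(\alpha(Y)+\beta(X))$ and the Courant bracket $[(X,\alpha),(Y,\beta)]=([X,Y],\,L_X\beta-L_Y\alpha+\frac12 d(\alpha(Y)-\beta(X)))$. For a bivector field $\pi$, $\sharp_\pi\alpha=i(\alpha)\pi$, i.e. $\beta(\sharp_\pi\alpha)=\pi(\alpha,\beta)$; for a $2$-form $\sigma$, $\flat_\sigma X=i(X)\sigma$. A generalized almost c.p.s. structure on $M$ is $\Phi\in\Gamma(End\,T^{big}M)$ with $g(\mathcal X,\Phi\mathcal Y)+g(\Phi\mathcal X,\mathcal Y)=0$ and $\Phi^2=\epsilon\,Id$, where $\epsilon=-1$ (complex), $\epsilon=1$ (paracomplex) or $\epsilon=0$ (subtangent). Equivalently, $\Phi(X,\alpha)=(AX+\sharp_\pi\alpha,\ \flat_\sigma X-\alpha\circ A)$ for a $(1,1)$-tensor field $A$, a bivector field $\pi$ and a $2$-form $\sigma$ (the classical tensor fields of $\Phi$) satisfying $A^2=\epsilon Id-\sharp_\pi\circ\flat_\sigma$, $\pi(\alpha\circ A,\beta)=\pi(\alpha,\beta\circ A)$, $\sigma(AX,Y)=\sigma(X,AY)$.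 $\Phi$ is integrable if $[\Phi\mathcal X,\Phi\mathcal Y]-\Phi[\mathcal X,\Phi\mathcal Y]-\Phi[\Phi\mathcal X,\mathcal Y]+\Phi^2[\mathcal X,\mathcal Y]=0$ for all sections $\mathcal X,\mathcal Y$ of $T^{big}M$ (Courant brackets). A pair $(w\in\chi^2(M),A\in\Gamma(End\,TM))$ is a Poisson-Nijenhuis structure if $w(\alpha\circ A,\beta)=w(\alpha,\beta\circ A)$ (compatibility), $[w,w]=0$ (Schouten-Nijenhuis bracket), the Nijenhuis tensor $\mathcal N_A$ vanishes, and the Schouten concomitant $C_{(w,A)}(\alpha,\beta)=\beta\circ L_{\sharp_w\alpha}A-\alpha\circ L_{\sharp_w\beta}A+d(w(\alpha,\beta))\circ A-d(w(\alpha\circ A,\beta))$ vanishes. If $w$ comes from a symplectic form $\sigma$, i.e. $\sharp_w\circ\flat_\sigma=-Id$, then $(\sigma,A)$ is called a symplectic-Nijenhuis structure. *)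

theory Defs
  imports "HOL-Analysis.Analysis"
begin

section \<open>Smooth maps between normed spaces\<close>

(* C^k on an open subset S of a Euclidean space: a map is C^(k+1) iff it is differentiable and
   all its directional derivatives are C^k. *)
primrec Ck_on :: "nat \<Rightarrow> 'a::euclidean_space set \<Rightarrow> ('a \<Rightarrow> 'b::real_normed_vector) \<Rightarrow> bool" where
  "Ck_on 0 S f \<longleftrightarrow> continuous_on S f"
| "Ck_on (Suc k) S f \<longleftrightarrow> (\<forall>x\<in>S. f differentiable (at x)) \<and>
     (\<forall>v. Ck_on k S (\<lambda>x. frechet_derivative f (at x) v))"

definition smooth_on :: "'a::euclidean_space set \<Rightarrow> ('a \<Rightarrow> 'b::real_normed_vector) \<Rightarrow> bool" where
  "smooth_on S f \<longleftrightarrow> (\<forall>k. Ck_on k S f)"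


section \<open>Smooth manifolds\<close>

(* A chart is a pair of a domain U and a coordinate map on U.  The manifold M is the universe of
   the type 'm, and it is modelled on the Euclidean space 'e. *)
type_synonym ('m, 'e) chart = "'m set \<times> ('m \<Rightarrow> 'e)"

abbreviation dom_ch :: "('m, 'e) chart \<Rightarrow> 'm set" where "dom_ch c \<equiv> fst c"
abbreviation crd :: "('m, 'e) chart \<Rightarrow> 'm \<Rightarrow> 'e" where "crd c \<equiv> snd c"
abbreviation img_ch :: "('m, 'e) chart \<Rightarrow> 'e set" where "img_ch c \<equiv> snd c ` fst c"

definition pt :: "('m, 'e) chart \<Rightarrow> 'e \<Rightarrow> 'm" where
  "pt c = inv_into (dom_ch c) (crd c)"

definition smooth_atlas ::
  "('m::{t2_space,second_countable_topology}, 'e::euclidean_space) chart set \<Rightarrow> bool" where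
  "smooth_atlas \<A> \<longleftrightarrow>
     (\<forall>c\<in>\<A>. open (dom_ch c) \<and> open (img_ch c) \<and>
             homeomorphism (dom_ch c) (img_ch c) (crd c) (pt c)) \<and>
     (\<Union>c\<in>\<A>. dom_ch c) = UNIV \<and>
     (\<forall>c\<in>\<A>. \<forall>c'\<in>\<A>. smooth_on (crd c ` (dom_ch c \<inter> dom_ch c')) (crd c' \<circ> pt c))"

(* The tangent space at p is identified with the model space 'e by means of the coordinates of a
   chart around p that is chosen once and for all: v in 'e stands for the tangent vector whose
   components in this preferred chart are v. *)
definition pref_chart :: "('m, 'e) chart set \<Rightarrow> 'm \<Rightarrow> ('m, 'e) chart" where
  "pref_chart \<A> p = (SOME c. c \<in> \<A> \<and> p \<in> dom_ch c)"

(* The coordinate vector of p in its preferred chart. *)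
definition pref_crd :: "('m, 'e) chart set \<Rightarrow> 'm \<Rightarrow> 'e" where
  "pref_crd \<A> p = crd (pref_chart \<A> p) p"

(* For p in the domain of the chart c: the isomorphism from the tangent space at p (components in
   the preferred chart) to 'e (components in c), i.e. the Jacobian of the coordinate change at p,
   and its inverse. *)
definition to_chart ::
  "('m, 'e::euclidean_space) chart set \<Rightarrow> ('m, 'e) chart \<Rightarrow> 'm \<Rightarrow> 'e \<Rightarrow>\<^sub>L 'e" where
  "to_chart \<A> c p =
     Blinfun (frechet_derivative (crd c \<circ> pt (pref_chart \<A> p)) (at (pref_crd \<A> p)))"

definition from_chart ::
  "('m, 'e::euclidean_space) chart set \<Rightarrow> ('m, 'e) chart \<Rightarrow> 'm \<Rightarrow> 'e \<Rightarrow>\<^sub>L 'e" where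
  "from_chart \<A> c p =
     Blinfun (frechet_derivative (crd (pref_chart \<A> p) \<circ> pt c) (at (crd c p)))"


section \<open>Tensor fields\<close>

type_synonym 'e covector = "'e \<Rightarrow>\<^sub>L real"
type_synonym ('m, 'e) vfield = "'m \<Rightarrow> 'e"
type_synonym ('m, 'e) form1 = "'m \<Rightarrow> 'e covector"
type_synonym ('m, 'e) endfield = "'m \<Rightarrow> 'e \<Rightarrow>\<^sub>L 'e"
type_synonym ('m, 'e) form2 = "'m \<Rightarrow> 'e \<Rightarrow>\<^sub>L 'e \<Rightarrow>\<^sub>L real"
type_synonym ('m, 'e) bivfield = "'m \<Rightarrow> 'e covector \<Rightarrow>\<^sub>L 'e covector \<Rightarrow>\<^sub>L real"
type_synonym 'e big = "'e \<times> 'e covector"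
type_synonym ('m, 'e) bigsection = "'m \<Rightarrow> 'e big"
type_synonym ('m, 'e) bigend = "'m \<Rightarrow> 'e big \<Rightarrow>\<^sub>L 'e big"

(* Components of the various tensor fields in the coordinates of a chart c.  They are functions of
   the coordinate x, with the tensor indices as further arguments. *)
definition vf_loc ::
  "('m, 'e::euclidean_space) chart set \<Rightarrow> ('m, 'e) chart \<Rightarrow> ('m, 'e) vfield \<Rightarrow> 'e \<Rightarrow> 'e" where
  "vf_loc \<A> c X x = to_chart \<A> c (pt c x) (X (pt c x))"

definition form1_loc ::
  "('m, 'e::euclidean_space) chart set \<Rightarrow> ('m, 'e) chart \<Rightarrow> ('m, 'e) form1 \<Rightarrow> 'e \<Rightarrow> 'e covector" where
  "form1_loc \<A> c \<alpha> x = \<alpha> (pt c x) o\<^sub>L from_chart \<A> c (pt c x)"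

definition end_loc ::
  "('m, 'e::euclidean_space) chart set \<Rightarrow> ('m, 'e) chart \<Rightarrow> ('m, 'e) endfield \<Rightarrow> 'e \<Rightarrow> 'e \<Rightarrow>\<^sub>L 'e" where
  "end_loc \<A> c A x = to_chart \<A> c (pt c x) o\<^sub>L A (pt c x) o\<^sub>L from_chart \<A> c (pt c x)"

definition form2_loc ::
  "('m, 'e::euclidean_space) chart set \<Rightarrow> ('m, 'e) chart \<Rightarrow> ('m, 'e) form2 \<Rightarrow>
   'e \<Rightarrow> 'e \<Rightarrow> 'e \<Rightarrow> real" where
  "form2_loc \<A> c \<sigma> x u v =
     \<sigma> (pt c x) (from_chart \<A> c (pt c x) u) (from_chart \<A> c (pt c x) v)"

definition biv_loc ::
  "('m, 'e::euclidean_space) chart set \<Rightarrow> ('m, 'e) chart \<Rightarrow> ('m, 'e) bivfield \<Rightarrow>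
   'e \<Rightarrow> 'e covector \<Rightarrow> 'e covector \<Rightarrow> real" where
  "biv_loc \<A> c w x \<xi> \<eta> =
     w (pt c x) (\<xi> o\<^sub>L to_chart \<A> c (pt c x)) (\<eta> o\<^sub>L to_chart \<A> c (pt c x))"

definition bigend_loc ::
  "('m, 'e::euclidean_space) chart set \<Rightarrow> ('m, 'e) chart \<Rightarrow> ('m, 'e) bigend \<Rightarrow>
   'e \<Rightarrow> 'e big \<Rightarrow> 'e big" where
  "bigend_loc \<A> c \<Phi> x z =
     (let p = pt c x;
          y = \<Phi> p (from_chart \<A> c p (fst z), snd z o\<^sub>L to_chart \<A> c p)
      in (to_chart \<A> c p (fst y), snd y o\<^sub>L from_chart \<A> c p))"

definition vector_field :: "('m, 'e::euclidean_space) chart set \<Rightarrow> ('m, 'e) vfield \<Rightarrow> bool" where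
  "vector_field \<A> X \<longleftrightarrow> (\<forall>c\<in>\<A>. smooth_on (img_ch c) (vf_loc \<A> c X))"

definition one_form :: "('m, 'e::euclidean_space) chart set \<Rightarrow> ('m, 'e) form1 \<Rightarrow> bool" where
  "one_form \<A> \<alpha> \<longleftrightarrow> (\<forall>c\<in>\<A>. smooth_on (img_ch c) (form1_loc \<A> c \<alpha>))"

definition end_field :: "('m, 'e::euclidean_space) chart set \<Rightarrow> ('m, 'e) endfield \<Rightarrow> bool" where
  "end_field \<A> A \<longleftrightarrow> (\<forall>c\<in>\<A>. smooth_on (img_ch c) (end_loc \<A> c A))"

definition two_form :: "('m, 'e::euclidean_space) chart set \<Rightarrow> ('m, 'e) form2 \<Rightarrow> bool" where
  "two_form \<A> \<sigma> \<longleftrightarrow> (\<forall>p u v. \<sigma> p u v = - \<sigma> p v u) \<and>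
     (\<forall>c\<in>\<A>. \<forall>u v. smooth_on (img_ch c) (\<lambda>x. form2_loc \<A> c \<sigma> x u v))"

definition bivector_field :: "('m, 'e::euclidean_space) chart set \<Rightarrow> ('m, 'e) bivfield \<Rightarrow> bool" where
  "bivector_field \<A> w \<longleftrightarrow> (\<forall>p \<xi> \<eta>. w p \<xi> \<eta> = - w p \<eta> \<xi>) \<and>
     (\<forall>c\<in>\<A>. \<forall>\<xi> \<eta>. smooth_on (img_ch c) (\<lambda>x. biv_loc \<A> c w x \<xi> \<eta>))"

definition big_section :: "('m, 'e::euclidean_space) chart set \<Rightarrow> ('m, 'e) bigsection \<Rightarrow> bool" where
  "big_section \<A> S \<longleftrightarrow> vector_field \<A> (fst \<circ> S) \<and> one_form \<A> (snd \<circ> S)"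

definition big_end_field :: "('m, 'e::euclidean_space) chart set \<Rightarrow> ('m, 'e) bigend \<Rightarrow> bool" where
  "big_end_field \<A> \<Phi> \<longleftrightarrow> (\<forall>c\<in>\<A>. \<forall>z. smooth_on (img_ch c) (\<lambda>x. bigend_loc \<A> c \<Phi> x z))"

(* The musical maps at a point: \<beta>(sharp w \<alpha>) = w(\<alpha>, \<beta>) and flat s v = i(v) s = s(v, _). *)
definition sharp :: "('e::euclidean_space covector \<Rightarrow>\<^sub>L 'e covector \<Rightarrow>\<^sub>L real) \<Rightarrow> 'e covector \<Rightarrow> 'e" where
  "sharp w \<alpha> = (THE v. \<forall>\<beta>. blinfun_apply \<beta> v = w \<alpha> \<beta>)"

definition flat :: "('e::euclidean_space \<Rightarrow>\<^sub>L 'e \<Rightarrow>\<^sub>L real) \<Rightarrow> 'e \<Rightarrow> 'e covector" where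
  "flat s v = blinfun_apply s v"


section \<open>Differential operators\<close>

(* All operators are given at p by their coordinate expressions in the preferred chart at p, whose
   coordinates are the ones used to identify the tangent space at p with 'e.  The components of a
   tensor at p in this chart are therefore the tensor at p itself. *)

definition differential ::
  "('m, 'e::euclidean_space) chart set \<Rightarrow> ('m \<Rightarrow> real) \<Rightarrow> ('m, 'e) form1" where
  "differential \<A> f p =
     Blinfun (frechet_derivative (f \<circ> pt (pref_chart \<A> p)) (at (pref_crd \<A> p)))"

(* The Jacobian at p of the components of X. *)
definition jac :: "('m, 'e::euclidean_space) chart set \<Rightarrow> ('m, 'e) vfield \<Rightarrow> ('m, 'e) endfield" where
  "jac \<A> X p =
     Blinfun (frechet_derivative (vf_loc \<A> (pref_chart \<A> p) X) (at (pref_crd \<A> p)))"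

definition lie_bracket ::
  "('m, 'e::euclidean_space) chart set \<Rightarrow> ('m, 'e) vfield \<Rightarrow> ('m, 'e) vfield \<Rightarrow> ('m, 'e) vfield" where
  "lie_bracket \<A> X Y p = jac \<A> Y p (X p) - jac \<A> X p (Y p)"

(* (L_X \<alpha>)_j = X^i d_i \<alpha>_j + \<alpha>_i d_j X^i *)
definition lie_form1 ::
  "('m, 'e::euclidean_space) chart set \<Rightarrow> ('m, 'e) vfield \<Rightarrow> ('m, 'e) form1 \<Rightarrow> ('m, 'e) form1" where
  "lie_form1 \<A> X \<alpha> p =
     frechet_derivative (form1_loc \<A> (pref_chart \<A> p) \<alpha>) (at (pref_crd \<A> p)) (X p)
     + (\<alpha> p o\<^sub>L jac \<A> X p)"

(* (L_X A)^k_j = X^i d_i A^k_j - A^i_j d_i X^k + A^k_i d_j X^i *)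
definition lie_end ::
  "('m, 'e::euclidean_space) chart set \<Rightarrow> ('m, 'e) vfield \<Rightarrow> ('m, 'e) endfield \<Rightarrow> ('m, 'e) endfield" where
  "lie_end \<A> X A p =
     frechet_derivative (end_loc \<A> (pref_chart \<A> p) A) (at (pref_crd \<A> p)) (X p)
     - (jac \<A> X p o\<^sub>L A p) + (A p o\<^sub>L jac \<A> X p)"

definition ext_deriv2 ::
  "('m, 'e::euclidean_space) chart set \<Rightarrow> ('m, 'e) form2 \<Rightarrow> 'm \<Rightarrow> 'e \<Rightarrow> 'e \<Rightarrow> 'e \<Rightarrow> real" where
  "ext_deriv2 \<A> \<sigma> p u v w =
     (let D = (\<lambda>a b. frechet_derivative (\<lambda>x. form2_loc \<A> (pref_chart \<A> p) \<sigma> x a b)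
                       (at (pref_crd \<A> p)))
      in D v w u + D w u v + D u v w)"

(* Schouten-Nijenhuis bracket of two bivector fields, a trivector field.  In components,
   [P,Q]^(ijk) is the cyclic sum over i, j, k of P^(il) d_l Q^(jk) + Q^(il) d_l P^(jk).  With
   (X \<and> Y)(\<alpha>,\<beta>) = \<alpha>(X)\<beta>(Y) - \<alpha>(Y)\<beta>(X), this is the bracket normalised by
   [X1 \<and> X2, Y1 \<and> Y2] = sum over i, j of (-1)^(i+j) [Xi,Yj] \<and> X(3-i) \<and> Y(3-j). *)
definition schouten ::
  "('m, 'e::euclidean_space) chart set \<Rightarrow> ('m, 'e) bivfield \<Rightarrow> ('m, 'e) bivfield \<Rightarrow> 'm \<Rightarrow>
   'e covector \<Rightarrow> 'e covector \<Rightarrow> 'e covector \<Rightarrow> real" where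
  "schouten \<A> P Q p \<xi> \<eta> \<zeta> =
     (let D = (\<lambda>w \<alpha> \<beta>. frechet_derivative (\<lambda>x. biv_loc \<A> (pref_chart \<A> p) w x \<alpha> \<beta>)
                         (at (pref_crd \<A> p)));
          T = (\<lambda>\<alpha> \<beta> \<gamma>. D Q \<beta> \<gamma> (sharp (P p) \<alpha>) + D P \<beta> \<gamma> (sharp (Q p) \<alpha>))
      in T \<xi> \<eta> \<zeta> + T \<eta> \<zeta> \<xi> + T \<zeta> \<xi> \<eta>)"


section \<open>Generalized almost c.p.s. structures\<close>

definition big_metric :: "'e::euclidean_space big \<Rightarrow> 'e big \<Rightarrow> real" where
  "big_metric x y = (snd x (fst y) + snd y (fst x)) / 2"

definition courant ::
  "('m, 'e::euclidean_space) chart set \<Rightarrow> ('m, 'e) bigsection \<Rightarrow> ('m, 'e) bigsection \<Rightarrow>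
   ('m, 'e) bigsection" where
  "courant \<A> S T =
     (let X = fst \<circ> S; \<alpha> = snd \<circ> S; Y = fst \<circ> T; \<beta> = snd \<circ> T
      in (\<lambda>p. (lie_bracket \<A> X Y p,
               lie_form1 \<A> X \<beta> p - lie_form1 \<A> Y \<alpha> p
               + (1/2) *\<^sub>R differential \<A> (\<lambda>q. \<alpha> q (Y q) - \<beta> q (X q)) p)))"

definition gen_almost_cps ::
  "('m, 'e::euclidean_space) chart set \<Rightarrow> real \<Rightarrow> ('m, 'e) bigend \<Rightarrow> bool" where
  "gen_almost_cps \<A> \<epsilon> \<Phi> \<longleftrightarrow>
     \<epsilon> \<in> {-1, 0, 1} \<and> big_end_field \<A> \<Phi> \<and>
     (\<forall>p x y. big_metric x (\<Phi> p y) + big_metric (\<Phi> p x) y = 0) \<and>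
     (\<forall>p x. \<Phi> p (\<Phi> p x) = \<epsilon> *\<^sub>R x)"

definition classical_tensor_fields ::
  "('m, 'e::euclidean_space) chart set \<Rightarrow> ('m, 'e) bigend \<Rightarrow>
   ('m, 'e) endfield \<Rightarrow> ('m, 'e) bivfield \<Rightarrow> ('m, 'e) form2 \<Rightarrow> bool" where
  "classical_tensor_fields \<A> \<Phi> A \<pi> \<sigma> \<longleftrightarrow>
     end_field \<A> A \<and> bivector_field \<A> \<pi> \<and> two_form \<A> \<sigma> \<and>
     (\<forall>p v \<alpha>. \<Phi> p (v, \<alpha>) = (A p v + sharp (\<pi> p) \<alpha>, flat (\<sigma> p) v - (\<alpha> o\<^sub>L A p)))"

definition gen_integrable ::
  "('m, 'e::euclidean_space) chart set \<Rightarrow> ('m, 'e) bigend \<Rightarrow> bool" where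
  "gen_integrable \<A> \<Phi> \<longleftrightarrow>
     (\<forall>S T. big_section \<A> S \<longrightarrow> big_section \<A> T \<longrightarrow>
        (let \<Phi>S = (\<lambda>p. \<Phi> p (S p)); \<Phi>T = (\<lambda>p. \<Phi> p (T p)) in
         \<forall>p. courant \<A> \<Phi>S \<Phi>T p - \<Phi> p (courant \<A> S \<Phi>T p) - \<Phi> p (courant \<A> \<Phi>S T p)
             + \<Phi> p (\<Phi> p (courant \<A> S T p)) = 0))"


section \<open>Poisson-Nijenhuis and symplectic-Nijenhuis structures\<close>

definition nijenhuis ::
  "('m, 'e::euclidean_space) chart set \<Rightarrow> ('m, 'e) endfield \<Rightarrow>
   ('m, 'e) vfield \<Rightarrow> ('m, 'e) vfield \<Rightarrow> ('m, 'e) vfield" where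
  "nijenhuis \<A> A X Y =
     (let AX = (\<lambda>p. A p (X p)); AY = (\<lambda>p. A p (Y p)) in
      (\<lambda>p. lie_bracket \<A> AX AY p - A p (lie_bracket \<A> X AY p) - A p (lie_bracket \<A> AX Y p)
           + A p (A p (lie_bracket \<A> X Y p))))"

definition schouten_concomitant ::
  "('m, 'e::euclidean_space) chart set \<Rightarrow> ('m, 'e) bivfield \<Rightarrow> ('m, 'e) endfield \<Rightarrow>
   ('m, 'e) form1 \<Rightarrow> ('m, 'e) form1 \<Rightarrow> ('m, 'e) form1" where
  "schouten_concomitant \<A> w A \<alpha> \<beta> p =
     (\<beta> p o\<^sub>L lie_end \<A> (\<lambda>q. sharp (w q) (\<alpha> q)) A p)
     - (\<alpha> p o\<^sub>L lie_end \<A> (\<lambda>q. sharp (w q) (\<beta> q)) A p)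
     + (differential \<A> (\<lambda>q. w q (\<alpha> q) (\<beta> q)) p o\<^sub>L A p)
     - differential \<A> (\<lambda>q. w q (\<alpha> q o\<^sub>L A q) (\<beta> q)) p"

definition poisson_nijenhuis ::
  "('m, 'e::euclidean_space) chart set \<Rightarrow> ('m, 'e) bivfield \<Rightarrow> ('m, 'e) endfield \<Rightarrow> bool" where
  "poisson_nijenhuis \<A> w A \<longleftrightarrow>
     bivector_field \<A> w \<and> end_field \<A> A \<and>
     (\<forall>p \<alpha> \<beta>. w p (\<alpha> o\<^sub>L A p) \<beta> = w p \<alpha> (\<beta> o\<^sub>L A p)) \<and>
     (\<forall>p \<xi> \<eta> \<zeta>. schouten \<A> w w p \<xi> \<eta> \<zeta> = 0) \<and>
     (\<forall>X Y. vector_field \<A> X \<longrightarrow> vector_field \<A> Y \<longrightarrow> (\<forall>p. nijenhuis \<A> A X Y p = 0)) \<and>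
     (\<forall>\<alpha> \<beta>. one_form \<A> \<alpha> \<longrightarrow> one_form \<A> \<beta> \<longrightarrow> (\<forall>p. schouten_concomitant \<A> w A \<alpha> \<beta> p = 0))"

definition symplectic :: "('m, 'e::euclidean_space) chart set \<Rightarrow> ('m, 'e) form2 \<Rightarrow> bool" where
  "symplectic \<A> \<sigma> \<longleftrightarrow> two_form \<A> \<sigma> \<and>
     (\<forall>p u v w. ext_deriv2 \<A> \<sigma> p u v w = 0) \<and>
     (\<forall>p u. (\<forall>v. \<sigma> p u v = 0) \<longrightarrow> u = 0)"

definition symplectic_nijenhuis ::
  "('m, 'e::euclidean_space) chart set \<Rightarrow> ('m, 'e) form2 \<Rightarrow> ('m, 'e) endfield \<Rightarrow> bool" where
  "symplectic_nijenhuis \<A> \<sigma> A \<longleftrightarrow> symplectic \<A> \<sigma> \<and>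
     (\<exists>w. poisson_nijenhuis \<A> w A \<and> (\<forall>p v. sharp (w p) (flat (\<sigma> p) v) = - v))"

end

theory Submission
  imports Defs
begin

text \<open>
  Let \<open>N(S, T)\<close> denote the Courant-Nijenhuis torsion of \<open>\<Phi>\<close>. From \<open>\<Phi>\<^sup>2 = \<epsilon> Id\<close> and the bilinearity of the
  Courant bracket over the constants one gets \<open>N(\<Phi> S, T) = N(S, \<Phi> T) = - \<Phi> N(S, T)\<close>. As \<open>\<sigma>\<close> is
  nondegenerate, \<open>T\<^sup>b\<^sup>i\<^sup>g M = TM \<oplus> \<Phi>(TM)\<close>, so \<open>\<Phi>\<close> is integrable iff \<open>N((X, 0), (Y, 0)) = 0\<close> for all
  vector fields \<open>X, Y\<close>. Using \<open>d\<sigma> = 0\<close>, the components of \<open>N((X, 0), (Y, 0))\<close> are the Nijenhuis tensor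
  \<open>N\<^sub>A(X, Y)\<close> and the Schouten concomitant \<open>C\<close> of \<open>(w, A)\<close> at \<open>(\<flat>\<^sub>\<sigma> X, \<flat>\<^sub>\<sigma> Y)\<close>, where \<open>w\<close> is the
  bivector field inverse to \<open>\<sigma>\<close>; every pair of 1-forms has this shape. Compatibility of \<open>w\<close> with \<open>A\<close> is
  contained in \<open>\<Phi>\<^sup>2 = \<epsilon> Id\<close>, and \<open>[w, w] = 0\<close> follows from \<open>d\<sigma> = 0\<close>.
\<close>

section \<open>Calculus of smooth maps\<close>

text \<open>Differentiability and the derivative at a point of the open set \<open>S\<close> depend
  only on values near that point, so equality on \<open>S\<close> suffices; the induction passes on
  to the directional derivatives.\<close>

lemma Ck_on_cong:
  assumes "open S" "\<And>x. x \<in> S \<Longrightarrow> f x = g x" "Ck_on k S f"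
  shows "Ck_on k S g"
  using assms(2,3)
proof (induction k arbitrary: f g)
  case 0
  then show ?case by (simp cong: continuous_on_cong)
next
  case (Suc k)
  have "g differentiable (at x)" if "x \<in> S" for x
  proof -
    have "f differentiable (at x)" using Suc.prems that by simp
    then show ?thesis unfolding differentiable_def
      using has_derivative_transform_within_open[OF _ assms(1) that, of f _ UNIV g] Suc.prems(1)
      by metis
  qed
  moreover have "Ck_on k S (\<lambda>x. frechet_derivative g (at x) v)" for v
  proof (rule Suc.IH)
    show "Ck_on k S (\<lambda>x. frechet_derivative f (at x) v)" using Suc.prems by simp
    show "frechet_derivative f (at x) v = frechet_derivative g (at x) v" if "x \<in> S" for x
      using frechet_derivative_transform_within_open[of f x S g] assms(1) that Suc.prems by simp
  qed
  ultimately show ?case by simp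
qed

lemma Ck_on_imp_continuous_on:
  assumes "open S" "Ck_on k S f"
  shows "continuous_on S f"
proof (cases k)
  case (Suc j)
  then show ?thesis using assms
    by (auto simp: continuous_on_eq_continuous_at differentiable_imp_continuous_within)
qed (use assms in simp)

text \<open>By uniqueness of the derivative, any explicit formula \<open>D\<close> may stand in for
  \<open>frechet_derivative\<close>. The sum, product and inversion rules can thus feed directly
  into inductions on \<open>k\<close>.\<close>

lemma Ck_on_SucI:
  assumes "open S" "\<And>x. x \<in> S \<Longrightarrow> (f has_derivative D x) (at x)"
    and "\<And>v. Ck_on k S (\<lambda>x. D x v)"
  shows "Ck_on (Suc k) S f"
proof -
  have "D x v = frechet_derivative f (at x) v" if "x \<in> S" for x v
    using frechet_derivative_at[OF assms(2)[OF that]] by simp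
  then show ?thesis
    using assms Ck_on_cong[OF assms(1) _ assms(3)] by (auto simp: differentiable_def)
qed

lemma Ck_on_SucD:
  assumes "Ck_on (Suc k) S f"
  shows "x \<in> S \<Longrightarrow> (f has_derivative frechet_derivative f (at x)) (at x)"
    and "Ck_on k S (\<lambda>x. frechet_derivative f (at x) v)"
  using assms by (auto simp: frechet_derivative_works[symmetric])

lemma Ck_on_Suc_imp:
  assumes "open S" "Ck_on (Suc k) S f"
  shows "Ck_on k S f"
  using assms(2)
proof (induction k arbitrary: f)
  case 0
  then show ?case using Ck_on_imp_continuous_on[OF assms(1) 0] by simp
next
  case (Suc k)
  show ?case
    by (rule Ck_on_SucI[OF assms(1)]) (use Suc Ck_on_SucD in blast)+
qed

lemma Ck_on_const: "open S \<Longrightarrow> Ck_on k S (\<lambda>_. c)"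
  by (induction k arbitrary: c) auto

lemma Ck_on_linear:
  assumes "open S" "bounded_linear L" "Ck_on k S f"
  shows "Ck_on k S (\<lambda>x. L (f x))"
  using assms(3)
proof (induction k arbitrary: f)
  case 0
  then show ?case by (simp add: bounded_linear.continuous_on[OF assms(2)])
next
  case (Suc k)
  show ?case
    by (rule Ck_on_SucI[OF assms(1) bounded_linear.has_derivative[OF assms(2) Ck_on_SucD(1)]])
      (use Suc Ck_on_SucD(2) in blast)+
qed

lemma Ck_on_add:
  assumes "open S" "Ck_on k S f" "Ck_on k S g"
  shows "Ck_on k S (\<lambda>x. f x + g x)"
  using assms(2,3)
proof (induction k arbitrary: f g)
  case 0
  then show ?case by (simp add: continuous_on_add)
next
  case (Suc k)
  show ?case
    by (rule Ck_on_SucI[OF assms(1) has_derivative_add[OF Ck_on_SucD(1) Ck_on_SucD(1)]])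
      (use Suc Ck_on_SucD(2) in blast)+
qed

text \<open>Each term of the product rule pairs one factor, lowered from order k+1 to order k, with
  a derivative of the other, so both terms fall under the induction hypothesis.\<close>

lemma Ck_on_bilinear:
  assumes "open S" "bounded_bilinear pr" "Ck_on k S f" "Ck_on k S g"
  shows "Ck_on k S (\<lambda>x. pr (f x) (g x))"
  using assms(3,4)
proof (induction k arbitrary: f g)
  case 0
  then show ?case by (simp add: bounded_bilinear.continuous_on[OF assms(2)])
next
  case (Suc k)
  show ?case
  proof (rule Ck_on_SucI[OF assms(1) bounded_bilinear.FDERIV[OF assms(2) Ck_on_SucD(1) Ck_on_SucD(1)]])
    show "Ck_on k S (\<lambda>x. pr (f x) (frechet_derivative g (at x) v) +
                         pr (frechet_derivative f (at x) v) (g x))" for v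
      by (rule Ck_on_add[OF assms(1) Suc.IH[OF Ck_on_Suc_imp[OF assms(1) Suc.prems(1)] Ck_on_SucD(2)[OF Suc.prems(2)]]
            Suc.IH[OF Ck_on_SucD(2)[OF Suc.prems(1)] Ck_on_Suc_imp[OF assms(1) Suc.prems(2)]]])
  qed (use Suc.prems in auto)
qed

text \<open>The key identity is \<open>W y - W x = - W y (B y - B x) W x\<close>, which bounds \<open>W\<close> locally and
  gives first its continuity and then its derivative \<open>- W (dB) W\<close>.\<close>

lemma inverse_diff:
  fixes B :: "'a \<Rightarrow> 'b::real_normed_vector \<Rightarrow>\<^sub>L 'c::real_normed_vector"
  assumes "W y o\<^sub>L B y = id_blinfun" "B x o\<^sub>L W x = id_blinfun"
  shows "W y - W x = - (W y o\<^sub>L (B y - B x) o\<^sub>L W x)"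
proof (rule blinfun_eqI)
  fix z
  have "W y (B y u) = u" for u using assms(1) by (metis blinfun_apply_blinfun_compose blinfun_apply_id_blinfun)
  moreover have "B x (W x z) = z" using assms(2) by (metis blinfun_apply_blinfun_compose blinfun_apply_id_blinfun)
  ultimately show "(W y - W x) z = (- (W y o\<^sub>L (B y - B x) o\<^sub>L W x)) z"
    by (simp add: blinfun.bilinear_simps)
qed

lemma inverse_continuous_at:
  fixes B :: "'a::euclidean_space \<Rightarrow> 'b::real_normed_vector \<Rightarrow>\<^sub>L 'c::real_normed_vector"
  assumes "open S" "x \<in> S" "isCont B x"
    and W1: "\<And>y. y \<in> S \<Longrightarrow> W y o\<^sub>L B y = id_blinfun"
    and W2: "\<And>y. y \<in> S \<Longrightarrow> B y o\<^sub>L W y = id_blinfun"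
  shows "isCont W x"
proof -
  define M where "M = norm (W x) + 1"
  have M: "M > 0" "norm (W x) \<le> M" by (simp_all add: M_def add_nonneg_pos)
  have lim: "((\<lambda>y. norm (B y - B x)) \<longlongrightarrow> 0) (at x)"
    using assms(3) by (simp add: isCont_def LIM_zero tendsto_norm_zero)
  have bd: "\<forall>\<^sub>F y in at x. norm (W y - W x) \<le> 2 * M * M * norm (B y - B x)"
  proof -
    \<comment> \<open>At this distance the key identity bounds \<open>norm (W y - W x)\<close> by
      half of \<open>norm (W y)\<close>. Absorbing that half on the left yields
      \<open>norm (W y) \<le> 2 * M\<close>, and this bound put back into the identity gives the
      estimate.\<close>
    have "\<forall>\<^sub>F y in at x. norm (B y - B x) < 1 / (2 * M)"
      using order_tendstoD(2)[OF lim, of "1 / (2*M)"] M by simp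
    moreover have "\<forall>\<^sub>F y in at x. y \<in> S"
      using assms(1,2) by (simp add: eventually_at_topological) blast
    ultimately show ?thesis
    proof eventually_elim
      case (elim y)
      have e: "norm (W y - W x) \<le> norm (W y) * norm (B y - B x) * M"
      proof -
        have "norm (W y - W x) \<le> norm (W y o\<^sub>L (B y - B x)) * norm (W x)"
          using inverse_diff[of W y B x] W1[of y] W2[of x] elim assms(2) norm_blinfun_compose
          by (metis norm_minus_cancel)
        also have "\<dots> \<le> (norm (W y) * norm (B y - B x)) * M"
          by (intro mult_mono norm_blinfun_compose M) auto
        finally show ?thesis .
      qed
      have "norm (B y - B x) * M \<le> 1 / 2"
        using elim M by (simp add: field_simps)
      then have "norm (W y) * (norm (B y - B x) * M) \<le> norm (W y) * (1/2)"
        by (intro mult_left_mono) auto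
      moreover have "norm (W y) \<le> norm (W y - W x) + M"
        using norm_triangle_ineq[of "W y - W x" "W x"] M by simp
      ultimately have "norm (W y) \<le> 2 * M" using e by (simp add: mult.assoc)
      then have "norm (W y) * (norm (B y - B x) * M) \<le> 2 * M * (norm (B y - B x) * M)"
        using M by (intro mult_right_mono) auto
      with e show ?case by (simp add: algebra_simps)
    qed
  qed
  have "((\<lambda>y. 2 * M * M * norm (B y - B x)) \<longlongrightarrow> 0) (at x)"
    using tendsto_mult_right_zero[OF lim] by simp
  then have "((\<lambda>y. W y - W x) \<longlongrightarrow> 0) (at x)"
    using bd by (rule Lim_null_comparison[rotated])
  then show ?thesis by (simp add: isCont_def LIM_zero_iff)
qed

lemma inverse_has_derivative:
  fixes B :: "'a::euclidean_space \<Rightarrow> 'b::real_normed_vector \<Rightarrow>\<^sub>L 'c::real_normed_vector"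
  assumes "open S" "x \<in> S" and B: "(B has_derivative B') (at x)"
    and W1: "\<And>y. y \<in> S \<Longrightarrow> W y o\<^sub>L B y = id_blinfun"
    and W2: "\<And>y. y \<in> S \<Longrightarrow> B y o\<^sub>L W y = id_blinfun"
  shows "(W has_derivative (\<lambda>v. - (W x o\<^sub>L B' v o\<^sub>L W x))) (at x)"
proof -
  interpret B': bounded_linear B' using B by (rule has_derivative_bounded_linear)
  have cont: "isCont W x"
    using inverse_continuous_at[OF assms(1,2) has_derivative_continuous[OF B]] W1 W2 by blast
  define R where "R y = norm (B y - B x - B' (y - x)) / norm (y - x)" for y
  have R: "(R \<longlongrightarrow> 0) (at x)"
    using B unfolding has_derivative_iff_norm R_def by blast
  obtain K where K: "\<And>v. norm (B' v) \<le> norm v * K" "K \<ge> 0"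
    using B'.nonneg_bounded by auto
  have "((\<lambda>y. norm (W y) * R y * norm (W x) + norm (W y - W x) * K * norm (W x)) \<longlongrightarrow> 
     norm (W x) * 0 * norm (W x) + 0 * K * norm (W x)) (at x)"
    using cont by (intro tendsto_intros R) (auto simp: isCont_def LIM_zero tendsto_norm_zero)
  then have lim: "((\<lambda>y. norm (W y) * R y * norm (W x) + norm (W y - W x) * K * norm (W x)) \<longlongrightarrow> 0) (at x)"
    by simp
  have "\<forall>\<^sub>F y in at x. y \<in> S \<and> y \<noteq> x"
    using assms(1,2) by (simp add: eventually_at_topological) blast
  then have "\<forall>\<^sub>F y in at x. norm (norm (W y - W x - - (W x o\<^sub>L B' (y - x) o\<^sub>L W x)) / norm (y - x))
      \<le> norm (W y) * R y * norm (W x) + norm (W y - W x) * K * norm (W x)"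
  proof eventually_elim
    case (elim y)
    let ?h = "y - x"
    have three: "norm (P o\<^sub>L D o\<^sub>L Q) \<le> norm P * norm D * norm Q"
      for P Q :: "'c \<Rightarrow>\<^sub>L 'b" and D
      by (meson norm_blinfun_compose order_trans mult_right_mono norm_ge_zero)
    have alg: "- (P o\<^sub>L (D - E) o\<^sub>L Q) - ((P - Q) o\<^sub>L E o\<^sub>L Q) = - (P o\<^sub>L D o\<^sub>L Q) + (Q o\<^sub>L E o\<^sub>L Q)"
      for P Q :: "'c \<Rightarrow>\<^sub>L 'b" and D E
      by (rule blinfun_eqI) (simp add: blinfun.bilinear_simps)
    \<comment> \<open>The error splits into a part containing the remainder of \<open>B\<close>,
      small by differentiability of \<open>B\<close>, and a part containing
      \<open>W y - W x\<close>, small by continuity of \<open>W\<close> at \<open>x\<close>.\<close>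
    have "W y - W x - - (W x o\<^sub>L B' ?h o\<^sub>L W x)
        = - (W y o\<^sub>L (B y - B x - B' ?h) o\<^sub>L W x) - ((W y - W x) o\<^sub>L B' ?h o\<^sub>L W x)"
      using alg[of "W y" "B y - B x" "B' ?h" "W x"] inverse_diff[of W y B x] W1[of y] W2[of x]
        elim assms(2) by simp
    then have "norm (W y - W x - - (W x o\<^sub>L B' ?h o\<^sub>L W x))
       \<le> norm (W y o\<^sub>L (B y - B x - B' ?h) o\<^sub>L W x) + norm ((W y - W x) o\<^sub>L B' ?h o\<^sub>L W x)"
      by (metis norm_minus_cancel norm_triangle_ineq4)
    also have "\<dots> \<le> norm (W y) * norm (B y - B x - B' ?h) * norm (W x)
         + norm (W y - W x) * (norm ?h * K) * norm (W x)"
      by (intro add_mono three K mult_left_mono mult_right_mono order_trans[OF three] norm_ge_zero)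
    also have "\<dots> = (norm (W y) * R y * norm (W x) + norm (W y - W x) * K * norm (W x)) * norm ?h"
      using elim by (simp add: R_def field_simps)
    finally show ?case using elim by (simp add: divide_le_eq)
  qed
  then have "((\<lambda>y. norm (W y - W x - - (W x o\<^sub>L B' (y - x) o\<^sub>L W x)) / norm (y - x)) \<longlongrightarrow> 0) (at x)"
    using lim by (rule Lim_null_comparison)
  then show ?thesis
    by (auto simp: has_derivative_iff_norm intro!: bounded_linear_intros B'.bounded_linear_axioms
       bounded_linear_minus)
qed

text \<open>Bootstrapping: once \<open>W\<close> is of order k, its derivative
  \<open>- (W o dB o W)\<close> is a product of maps of order k, so \<open>W\<close> is of order
  k+1.\<close>

lemma Ck_on_inverse:
  fixes B :: "'a::euclidean_space \<Rightarrow> 'b::real_normed_vector \<Rightarrow>\<^sub>L 'c::real_normed_vector"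
  assumes "open S" "Ck_on k S B"
    and W1: "\<And>y. y \<in> S \<Longrightarrow> W y o\<^sub>L B y = id_blinfun"
    and W2: "\<And>y. y \<in> S \<Longrightarrow> B y o\<^sub>L W y = id_blinfun"
  shows "Ck_on k S W"
  using assms(2)
proof (induction k)
  case 0
  then show ?case
    using inverse_continuous_at[OF assms(1) _ _ W1 W2]
    by (simp add: continuous_on_eq_continuous_at[OF assms(1)])
next
  case (Suc k)
  then have "Ck_on k S W" using Ck_on_Suc_imp[OF assms(1)] by blast
  then have *: "Ck_on k S (\<lambda>x. - (W x o\<^sub>L frechet_derivative B (at x) v o\<^sub>L W x))" for v
    using Ck_on_SucD(2)[OF Suc.prems]
    by (intro Ck_on_linear[OF assms(1) bounded_linear_minus[OF bounded_linear_ident]]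
        Ck_on_bilinear[OF assms(1) bounded_bilinear_blinfun_compose])
  show ?case
    by (rule Ck_on_SucI[OF assms(1)
        inverse_has_derivative[OF assms(1) _ Ck_on_SucD(1)[OF Suc.prems] W1 W2] *])
qed

section \<open>Closure rules for smooth maps\<close>

lemma smooth_on_cong:
  "open S \<Longrightarrow> smooth_on S f \<Longrightarrow> (\<And>x. x \<in> S \<Longrightarrow> f x = g x) \<Longrightarrow> smooth_on S g"
  unfolding smooth_on_def using Ck_on_cong[of S f g] by simp

lemma smooth_on_const: "open S \<Longrightarrow> smooth_on S (\<lambda>_. c)"
  by (simp add: smooth_on_def Ck_on_const)

lemma smooth_on_linear:
  "open S \<Longrightarrow> bounded_linear L \<Longrightarrow> smooth_on S f \<Longrightarrow> smooth_on S (\<lambda>x. L (f x))"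
  by (simp add: smooth_on_def Ck_on_linear)

lemma smooth_on_add:
  "open S \<Longrightarrow> smooth_on S f \<Longrightarrow> smooth_on S g \<Longrightarrow> smooth_on S (\<lambda>x. f x + g x)"
  by (simp add: smooth_on_def Ck_on_add)

lemma smooth_on_sum:
  "open S \<Longrightarrow> (\<And>i. i \<in> I \<Longrightarrow> smooth_on S (f i)) \<Longrightarrow> smooth_on S (\<lambda>x. \<Sum>i\<in>I. f i x)"
  by (induction I rule: infinite_finite_induct) (simp_all add: smooth_on_const smooth_on_add)

lemma smooth_on_bilinear:
  "open S \<Longrightarrow> bounded_bilinear pr \<Longrightarrow> smooth_on S f \<Longrightarrow> smooth_on S g \<Longrightarrow>
    smooth_on S (\<lambda>x. pr (f x) (g x))"
  by (simp add: smooth_on_def Ck_on_bilinear)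

lemma smooth_on_inverse:
  fixes B :: "'a::euclidean_space \<Rightarrow> 'b::real_normed_vector \<Rightarrow>\<^sub>L 'c::real_normed_vector"
  assumes "open S" "smooth_on S B"
    and "\<And>y. y \<in> S \<Longrightarrow> W y o\<^sub>L B y = id_blinfun" "\<And>y. y \<in> S \<Longrightarrow> B y o\<^sub>L W y = id_blinfun"
  shows "smooth_on S W"
  unfolding smooth_on_def using Ck_on_inverse[OF assms(1) _ assms(3,4)] assms(2)
  by (simp add: smooth_on_def)

lemma smooth_on_has_derivative:
  "smooth_on S f \<Longrightarrow> x \<in> S \<Longrightarrow> (f has_derivative frechet_derivative f (at x)) (at x)"
  by (rule Ck_on_SucD(1)[of 0]) (simp_all only: smooth_on_def)

text \<open>A linear map on a Euclidean space is the finite sum of its columns times the coordinate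
  functionals, so smoothness on each fixed vector gives smoothness in operator norm. This carries
  the componentwise smoothness in \<open>two_form\<close> over to operator-valued maps.\<close>

lemma smooth_on_blinfunI:
  fixes f :: "'a::euclidean_space \<Rightarrow> 'b::euclidean_space \<Rightarrow>\<^sub>L 'c::real_normed_vector"
  assumes "open S" "\<And>v. smooth_on S (\<lambda>x. f x v)"
  shows "smooth_on S f"
proof -
  have "(\<Sum>b\<in>Basis. blinfun_scaleR_left (f x b) o\<^sub>L blinfun_inner_right b) = f x" for x
  proof (rule blinfun_euclidean_eqI)
    fix i :: 'b assume i: "i \<in> Basis"
    have "(\<Sum>b\<in>Basis. (b \<bullet> i) *\<^sub>R f x b) = f x i"
      using i by (subst sum.remove[OF _ i]) (auto simp: inner_not_same_Basis intro!: sum.neutral)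
    then show "(\<Sum>b\<in>Basis. blinfun_scaleR_left (f x b) o\<^sub>L blinfun_inner_right b) i = f x i"
      using i by (simp add: blinfun.sum_left blinfun_inner_right.rep_eq)
  qed
  moreover have "smooth_on S (\<lambda>x. \<Sum>b\<in>Basis. blinfun_scaleR_left (f x b) o\<^sub>L blinfun_inner_right b)"
    using assms by (intro smooth_on_sum smooth_on_linear[where L = "\<lambda>y. blinfun_scaleR_left y o\<^sub>L blinfun_inner_right b" for b]
        bounded_linear_intros)
  ultimately show ?thesis by (simp only:)
qed

section \<open>Linear algebra of sharp and flat\<close>

lemma covector_expand:
  fixes \<xi> :: "'e::euclidean_space covector"
  shows "\<xi> = (\<Sum>b\<in>Basis. \<xi> b *\<^sub>R blinfun_inner_right b)"
proof (rule blinfun_eqI)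
  fix v
  have "\<xi> v = \<xi> (\<Sum>b\<in>Basis. (v \<bullet> b) *\<^sub>R b)" by (simp add: euclidean_representation)
  then show "\<xi> v = (\<Sum>b\<in>Basis. \<xi> b *\<^sub>R blinfun_inner_right b) v"
    by (simp add: blinfun.bilinear_simps blinfun_inner_right.rep_eq inner_commute mult.commute)
qed

lemma vector_eqI_covector:
  fixes u v :: "'e::euclidean_space"
  assumes "\<And>\<beta>::'e covector. \<beta> u = \<beta> v"
  shows "u = v"
proof (rule euclidean_eqI)
  show "u \<bullet> b = v \<bullet> b" for b
    using assms[of "blinfun_inner_right b"] by (simp add: blinfun_inner_right.rep_eq inner_commute)
qed

text \<open>Justifies the definite description in \<open>sharp\<close>: the vector with coordinates
  \<open>w \<alpha>\<close> on the dual basis represents the functional, and covectors separate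
  vectors.\<close>

lemma covector_sharp: "blinfun_apply \<beta> (sharp w \<alpha>) = w \<alpha> \<beta>"
proof -
  let ?v = "\<Sum>b\<in>Basis. w \<alpha> (blinfun_inner_right b) *\<^sub>R b"
  have v: "blinfun_apply \<gamma> ?v = w \<alpha> \<gamma>" for \<gamma>
  proof -
    have "w \<alpha> \<gamma> = w \<alpha> (\<Sum>b\<in>Basis. \<gamma> b *\<^sub>R blinfun_inner_right b)"
      by (subst covector_expand[of \<gamma>]) (rule refl)
    then show ?thesis by (simp add: blinfun.bilinear_simps mult.commute)
  qed
  have "sharp w \<alpha> = ?v"
    unfolding sharp_def by (rule the_equality) (auto simp: v intro: vector_eqI_covector)
  then show ?thesis using v by simp
qed

lemma sharp_eqI: "(\<And>\<beta>. blinfun_apply \<beta> v = blinfun_apply (blinfun_apply w \<alpha>) \<beta>) \<Longrightarrow> sharp w \<alpha> = v"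
  by (rule vector_eqI_covector) (simp add: covector_sharp)

lemma sharp_zero: "sharp w 0 = 0"
  by (rule sharp_eqI) simp

lemma sharp_add: "sharp w (\<alpha> + \<beta>) = sharp w \<alpha> + sharp w \<beta>"
  by (rule sharp_eqI) (simp add: blinfun.bilinear_simps covector_sharp)

text \<open>Identifying covectors with vectors through the basis (\<open>R\<close>) turns
  \<open>s\<close> into an injective endomorphism of \<open>'e\<close>, which is bijective because
  the dimension is finite.\<close>

lemma nondegenerate_inverse:
  fixes s :: "'e::euclidean_space \<Rightarrow>\<^sub>L 'e covector"
  assumes "\<And>u. (\<And>v. s u v = 0) \<Longrightarrow> u = 0"
  obtains r where "r o\<^sub>L s = id_blinfun" "s o\<^sub>L r = id_blinfun"
proof -
  define R :: "'e covector \<Rightarrow> 'e" where "R \<xi> = (\<Sum>b\<in>Basis. \<xi> b *\<^sub>R b)" for \<xi>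
  have R: "bounded_linear R" unfolding R_def by (intro bounded_linear_intros)
  have R_inj: "\<xi> = \<eta>" if "R \<xi> = R \<eta>" for \<xi> \<eta>
  proof (rule blinfun_euclidean_eqI)
    fix b :: 'e assume "b \<in> Basis"
    then show "\<xi> b = \<eta> b" using arg_cong[OF that, of "\<lambda>v. v \<bullet> b"]
      by (simp add: R_def inner_sum_left inner_Basis if_distrib cong: if_cong)
  qed
  have lin: "bounded_linear (\<lambda>v. R (s v))"
    using bounded_linear_compose[OF R] blinfun.bounded_linear_right by blast
  then interpret T: linear "\<lambda>v. R (s v)" by (rule bounded_linear.linear)
  have inj: "inj (\<lambda>v. R (s v))"
    unfolding linear_injective_0[OF T.linear_axioms]
  proof (intro allI impI)
    fix v assume "R (s v) = 0"
    moreover have "R 0 = 0" by (simp add: R_def)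
    ultimately have "s v = 0" using R_inj by metis
    then show "v = 0" using assms by simp
  qed
  obtain T' where T': "linear T'" "\<And>v. T' (R (s v)) = v" "\<And>v. R (s (T' v)) = v"
    using linear_injective_isomorphism[OF T.linear_axioms inj] by blast
  define r where "r = Blinfun (\<lambda>\<xi>. T' (R \<xi>))"
  have r: "r \<xi> = T' (R \<xi>)" for \<xi>
    using bounded_linear_compose[OF linear_conv_bounded_linear[THEN iffD1, OF T'(1)] R]
    by (simp add: r_def bounded_linear_Blinfun_apply)
  show thesis
  proof
    show "r o\<^sub>L s = id_blinfun" using T'(2) by (auto intro!: blinfun_eqI simp: r)
    show "s o\<^sub>L r = id_blinfun"
      using T'(3) by (auto intro!: blinfun_eqI[of _ id_blinfun] R_inj simp: r)
  qed
qed

section \<open>Smooth fields in charts\<close>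

locale atlas =
  fixes \<A> :: "('m::{t2_space,second_countable_topology}, 'e::euclidean_space) chart set"
  assumes smooth_atlas: "smooth_atlas \<A>"
begin

lemma open_img: "c \<in> \<A> \<Longrightarrow> open (img_ch c)"
  and open_dom: "c \<in> \<A> \<Longrightarrow> open (dom_ch c)"
  and chart_homeo: "c \<in> \<A> \<Longrightarrow> homeomorphism (dom_ch c) (img_ch c) (crd c) (pt c)"
  and transition_smooth: "c \<in> \<A> \<Longrightarrow> c' \<in> \<A> \<Longrightarrow>
     smooth_on (crd c ` (dom_ch c \<inter> dom_ch c')) (crd c' \<circ> pt c)"
  using smooth_atlas unfolding smooth_atlas_def by auto

lemma pt_crd: "c \<in> \<A> \<Longrightarrow> q \<in> dom_ch c \<Longrightarrow> pt c (crd c q) = q"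
  and crd_pt: "c \<in> \<A> \<Longrightarrow> x \<in> img_ch c \<Longrightarrow> crd c (pt c x) = x"
  and pt_in: "c \<in> \<A> \<Longrightarrow> x \<in> img_ch c \<Longrightarrow> pt c x \<in> dom_ch c"
  using chart_homeo[of c] by (auto simp: homeomorphism_def)

lemma pref_chart: "pref_chart \<A> p \<in> \<A>" "p \<in> dom_ch (pref_chart \<A> p)"
proof -
  have "\<exists>c. c \<in> \<A> \<and> p \<in> dom_ch c" using smooth_atlas unfolding smooth_atlas_def by blast
  then have "pref_chart \<A> p \<in> \<A> \<and> p \<in> dom_ch (pref_chart \<A> p)"
    unfolding pref_chart_def by (rule someI_ex)
  then show "pref_chart \<A> p \<in> \<A>" "p \<in> dom_ch (pref_chart \<A> p)" by auto
qed

lemma pref_crd_in: "pref_crd \<A> p \<in> img_ch (pref_chart \<A> p)"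
  and pt_pref_crd: "pt (pref_chart \<A> p) (pref_crd \<A> p) = p"
  using pref_chart[of p] pt_crd by (auto simp: pref_crd_def)

lemma open_overlap:
  assumes "c \<in> \<A>" "c' \<in> \<A>"
  shows "open (crd c ` (dom_ch c \<inter> dom_ch c'))"
proof -
  have "crd c ` (dom_ch c \<inter> dom_ch c') = img_ch c \<inter> pt c -` dom_ch c'"
    using pt_crd[OF assms(1)] by force
  moreover have "continuous_on (img_ch c) (pt c)"
    using chart_homeo[OF assms(1)] by (simp add: homeomorphism_def)
  ultimately show ?thesis
    using continuous_open_preimage[OF _ open_img[OF assms(1)] open_dom[OF assms(2)]] by simp
qed

text \<open>Chain rule for the two opposite coordinate changes, whose composite is the identity on
  the open overlap around \<open>crd c q\<close>.\<close>

lemma transition_jacobian_inverse: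
  assumes "c \<in> \<A>" "c' \<in> \<A>" "q \<in> dom_ch c" "q \<in> dom_ch c'"
  shows "Blinfun (frechet_derivative (crd c \<circ> pt c') (at (crd c' q)))
     o\<^sub>L Blinfun (frechet_derivative (crd c' \<circ> pt c) (at (crd c q))) = id_blinfun"
proof -
  let ?D = "frechet_derivative (crd c' \<circ> pt c) (at (crd c q))"
  let ?D' = "frechet_derivative (crd c \<circ> pt c') (at (crd c' q))"
  have D: "((crd c' \<circ> pt c) has_derivative ?D) (at (crd c q))"
    using assms by (intro smooth_on_has_derivative[OF transition_smooth]) auto
  have D': "((crd c \<circ> pt c') has_derivative ?D') (at (crd c' q))"
    using assms by (intro smooth_on_has_derivative[OF transition_smooth]) auto
  have "(crd c' \<circ> pt c) (crd c q) = crd c' q" using assms pt_crd by simp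
  then have "((crd c \<circ> pt c') \<circ> (crd c' \<circ> pt c) has_derivative ?D' \<circ> ?D) (at (crd c q))"
    using diff_chain_at[OF D] D' by simp
  moreover have "((crd c \<circ> pt c') \<circ> (crd c' \<circ> pt c) has_derivative (\<lambda>v. v)) (at (crd c q))"
    by (rule has_derivative_transform_within_open[OF has_derivative_ident open_overlap[OF assms(1,2)]])
      (use assms(3,4) in \<open>auto simp: pt_crd[OF assms(1)] pt_crd[OF assms(2)]\<close>)
  ultimately have "?D' \<circ> ?D = (\<lambda>v. v)" by (rule has_derivative_unique)
  then show ?thesis
    using D D' by (auto intro!: blinfun_eqI
        simp: bounded_linear_Blinfun_apply[OF has_derivative_bounded_linear] fun_eq_iff)
qed

lemma to_from_chart:
  assumes "c \<in> \<A>" "q \<in> dom_ch c"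
  shows "to_chart \<A> c q (from_chart \<A> c q v) = v" "from_chart \<A> c q (to_chart \<A> c q v) = v"
    "to_chart \<A> c q o\<^sub>L from_chart \<A> c q = id_blinfun" "from_chart \<A> c q o\<^sub>L to_chart \<A> c q = id_blinfun"
proof -
  show 1: "to_chart \<A> c q o\<^sub>L from_chart \<A> c q = id_blinfun"
    unfolding to_chart_def from_chart_def pref_crd_def
    using transition_jacobian_inverse[OF assms(1) pref_chart(1) assms(2) pref_chart(2)] .
  show 2: "from_chart \<A> c q o\<^sub>L to_chart \<A> c q = id_blinfun"
    unfolding to_chart_def from_chart_def pref_crd_def
    using transition_jacobian_inverse[OF pref_chart(1) assms(1) pref_chart(2) assms(2)] .
  show "to_chart \<A> c q (from_chart \<A> c q v) = v" using 1 
    by (metis blinfun_apply_blinfun_compose blinfun_apply_id_blinfun)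
  show "from_chart \<A> c q (to_chart \<A> c q v) = v" using 2
    by (metis blinfun_apply_blinfun_compose blinfun_apply_id_blinfun)
qed

text \<open>The change from a chart to itself is the identity near the point. Hence the components
  at \<open>p\<close> in the preferred chart are the values at \<open>p\<close>, and the coordinate
  formulas for the operators carry no Jacobians there.\<close>

lemma pref_chart_id:
  "to_chart \<A> (pref_chart \<A> p) p = id_blinfun" "from_chart \<A> (pref_chart \<A> p) p = id_blinfun"
proof -
  let ?c = "pref_chart \<A> p"
  have "((crd ?c \<circ> pt ?c) has_derivative (\<lambda>v. v)) (at (pref_crd \<A> p))"
    by (rule has_derivative_transform_within_open[OF has_derivative_ident open_img[OF pref_chart(1)] pref_crd_in])
      (simp add: crd_pt[OF pref_chart(1)])
  then have "frechet_derivative (crd ?c \<circ> pt ?c) (at (pref_crd \<A> p)) = (\<lambda>v. v)"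
    by (rule frechet_derivative_at[symmetric])
  then show "to_chart \<A> ?c p = id_blinfun" "from_chart \<A> ?c p = id_blinfun"
    unfolding to_chart_def from_chart_def pref_crd_def id_blinfun_def by simp_all
qed

section \<open>Components of contractions: the Jacobians between the factors cancel\<close>

lemma vf_loc_end:
  fixes A :: "('m, 'e) endfield"
  assumes "c \<in> \<A>" "x \<in> img_ch c"
  shows "vf_loc \<A> c (\<lambda>q. A q (X q)) x = end_loc \<A> c A x (vf_loc \<A> c X x)"
  using to_from_chart(2)[OF assms(1) pt_in[OF assms]] by (simp add: vf_loc_def end_loc_def)

lemma pairing_loc:
  fixes \<alpha> :: "('m, 'e) form1"
  assumes "c \<in> \<A>" "x \<in> img_ch c"
  shows "form1_loc \<A> c \<alpha> x (vf_loc \<A> c Y x) = \<alpha> (pt c x) (Y (pt c x))"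
  using to_from_chart(2)[OF assms(1) pt_in[OF assms]] by (simp add: vf_loc_def form1_loc_def)

lemma form1_loc_end:
  assumes "c \<in> \<A>" "x \<in> img_ch c"
  shows "form1_loc \<A> c (\<lambda>q. \<alpha> q o\<^sub>L A q) x = form1_loc \<A> c \<alpha> x o\<^sub>L end_loc \<A> c A x"
  using to_from_chart(2)[OF assms(1) pt_in[OF assms]]
  by (auto intro!: blinfun_eqI simp: form1_loc_def end_loc_def)

text \<open>The components \<open>form2_loc\<close> bundled into one operator, namely the flat map
  read in the chart \<open>c\<close>. In this form the 2-form can be inverted as an operator and
  differentiated by the bilinear product rule.\<close>

definition form2_blin :: "('m, 'e) chart \<Rightarrow> ('m, 'e) form2 \<Rightarrow> 'e \<Rightarrow> 'e \<Rightarrow>\<^sub>L 'e covector" where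
  "form2_blin c \<sigma> x = Blinfun (\<lambda>\<xi>. \<xi> o\<^sub>L from_chart \<A> c (pt c x)) o\<^sub>L \<sigma> (pt c x) o\<^sub>L from_chart \<A> c (pt c x)"

lemma form2_blin_apply: "form2_blin c \<sigma> x u v = form2_loc \<A> c \<sigma> x u v"
proof -
  have "bounded_linear (\<lambda>\<xi>::'e covector. \<xi> o\<^sub>L from_chart \<A> c (pt c x))"
    by (intro bounded_linear_intros)
  then show ?thesis
    by (simp add: form2_blin_def form2_loc_def bounded_linear_Blinfun_apply)
qed

lemma form1_loc_flat:
  assumes "c \<in> \<A>" "x \<in> img_ch c"
  shows "form1_loc \<A> c (\<lambda>q. flat (\<sigma> q) (X q)) x = form2_blin c \<sigma> x (vf_loc \<A> c X x)"
  using to_from_chart(2)[OF assms(1) pt_in[OF assms]]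
  by (auto intro!: blinfun_eqI simp: form2_blin_apply form1_loc_def form2_loc_def flat_def vf_loc_def)

lemma smooth_form2_blin:
  assumes "c \<in> \<A>" "two_form \<A> \<sigma>"
  shows "smooth_on (img_ch c) (form2_blin c \<sigma>)"
  using assms open_img
  by (intro smooth_on_blinfunI) (auto simp: form2_blin_apply two_form_def)

text \<open>Bivector fields are smooth componentwise by definition, so \<open>sharp\<close> is
  written as a finite sum of products of smooth component functions.\<close>

lemma vf_loc_sharp:
  assumes "c \<in> \<A>" "x \<in> img_ch c"
  shows "vf_loc \<A> c (\<lambda>q. sharp (w q) (\<alpha> q)) x = 
   (\<Sum>b\<in>Basis. (\<Sum>b'\<in>Basis. form1_loc \<A> c \<alpha> x b' *
     biv_loc \<A> c w x (blinfun_inner_right b') (blinfun_inner_right b)) *\<^sub>R b)"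
proof (rule euclidean_eqI)
  fix b :: 'e assume b: "b \<in> Basis"
  let ?t = "to_chart \<A> c (pt c x)"
  have cov: "bounded_linear (\<lambda>\<xi>. w (pt c x) (\<xi> o\<^sub>L ?t) \<eta>)" for \<eta>
    by (intro bounded_linear_intros)
  have "vf_loc \<A> c (\<lambda>q. sharp (w q) (\<alpha> q)) x \<bullet> b =
      (blinfun_inner_right b o\<^sub>L ?t) (sharp (w (pt c x)) (\<alpha> (pt c x)))"
    by (simp add: vf_loc_def blinfun_inner_right.rep_eq inner_commute)
  also have "\<dots> = w (pt c x) (\<alpha> (pt c x)) (blinfun_inner_right b o\<^sub>L ?t)" by (rule covector_sharp)
  also have "\<alpha> (pt c x) = form1_loc \<A> c \<alpha> x o\<^sub>L ?t"
    using to_from_chart(2)[OF assms(1) pt_in[OF assms]]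
    by (auto intro!: blinfun_eqI simp: form1_loc_def)
  also have "w (pt c x) (form1_loc \<A> c \<alpha> x o\<^sub>L ?t) (blinfun_inner_right b o\<^sub>L ?t) = 
    (\<Sum>b'\<in>Basis. form1_loc \<A> c \<alpha> x b' *
       biv_loc \<A> c w x (blinfun_inner_right b') (blinfun_inner_right b))"
    by (subst covector_expand[of "form1_loc \<A> c \<alpha> x"]) 
      (simp add: linear_sum[OF bounded_linear.linear[OF cov]] linear_scale[OF bounded_linear.linear[OF cov]] biv_loc_def)
  finally show "vf_loc \<A> c (\<lambda>q. sharp (w q) (\<alpha> q)) x \<bullet> b = (\<Sum>b\<in>Basis. (\<Sum>b'\<in>Basis. form1_loc \<A> c \<alpha> x b' *
     biv_loc \<A> c w x (blinfun_inner_right b') (blinfun_inner_right b)) *\<^sub>R b) \<bullet> b"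
    using b by simp
qed

section \<open>Smoothness of contracted fields\<close>

lemma vector_field_end:
  fixes A :: "('m, 'e) endfield"
  assumes "end_field \<A> A" "vector_field \<A> X"
  shows "vector_field \<A> (\<lambda>q. A q (X q))"
  unfolding vector_field_def
proof
  fix c assume c: "c \<in> \<A>"
  have "smooth_on (img_ch c) (\<lambda>x. end_loc \<A> c A x (vf_loc \<A> c X x))"
    using assms c unfolding end_field_def vector_field_def
    by (intro smooth_on_bilinear[OF open_img[OF c] bounded_bilinear_blinfun_apply]) auto
  then show "smooth_on (img_ch c) (vf_loc \<A> c (\<lambda>q. A q (X q)))"
    by (rule smooth_on_cong[OF open_img[OF c]]) (simp add: vf_loc_end[OF c])
qed

lemma one_form_end:
  assumes "end_field \<A> A" "one_form \<A> \<alpha>"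
  shows "one_form \<A> (\<lambda>q. \<alpha> q o\<^sub>L A q)"
  unfolding one_form_def
proof
  fix c assume c: "c \<in> \<A>"
  have "smooth_on (img_ch c) (\<lambda>x. form1_loc \<A> c \<alpha> x o\<^sub>L end_loc \<A> c A x)"
    using assms c unfolding end_field_def one_form_def
    by (intro smooth_on_bilinear[OF open_img[OF c] bounded_bilinear_blinfun_compose]) auto
  then show "smooth_on (img_ch c) (form1_loc \<A> c (\<lambda>q. \<alpha> q o\<^sub>L A q))"
    by (rule smooth_on_cong[OF open_img[OF c]]) (simp add: form1_loc_end[OF c])
qed

lemma one_form_flat:
  assumes "two_form \<A> \<sigma>" "vector_field \<A> X"
  shows "one_form \<A> (\<lambda>q. flat (\<sigma> q) (X q))"
  unfolding one_form_def
proof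
  fix c assume c: "c \<in> \<A>"
  have "smooth_on (img_ch c) (\<lambda>x. form2_blin c \<sigma> x (vf_loc \<A> c X x))"
    using assms c smooth_form2_blin unfolding vector_field_def
    by (intro smooth_on_bilinear[OF open_img[OF c] bounded_bilinear_blinfun_apply]) auto
  then show "smooth_on (img_ch c) (form1_loc \<A> c (\<lambda>q. flat (\<sigma> q) (X q)))"
    by (rule smooth_on_cong[OF open_img[OF c]]) (simp add: form1_loc_flat[OF c])
qed

lemma vector_field_sharp:
  assumes "bivector_field \<A> w" "one_form \<A> \<alpha>"
  shows "vector_field \<A> (\<lambda>q. sharp (w q) (\<alpha> q))"
  unfolding vector_field_def
proof
  fix c assume c: "c \<in> \<A>"
  have 1: "smooth_on (img_ch c) (\<lambda>x. form1_loc \<A> c \<alpha> x b)" for b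
    using smooth_on_linear[OF open_img[OF c] blinfun.bounded_linear_left] assms c
    unfolding one_form_def by blast
  have 2: "smooth_on (img_ch c) (\<lambda>x. biv_loc \<A> c w x \<xi> \<eta>)" for \<xi> \<eta>
    using assms c unfolding bivector_field_def by blast
  have "smooth_on (img_ch c) (\<lambda>x. \<Sum>b\<in>Basis. (\<Sum>b'\<in>Basis. form1_loc \<A> c \<alpha> x b' *
     biv_loc \<A> c w x (blinfun_inner_right b') (blinfun_inner_right b)) *\<^sub>R b)"
    by (intro smooth_on_sum[OF open_img[OF c]] 
        smooth_on_linear[OF open_img[OF c] bounded_linear_scaleR_left]
        smooth_on_bilinear[OF open_img[OF c] bounded_bilinear_mult] 1 2)
  then show "smooth_on (img_ch c) (vf_loc \<A> c (\<lambda>q. sharp (w q) (\<alpha> q)))"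
    by (rule smooth_on_cong[OF open_img[OF c]]) (simp add: vf_loc_sharp[OF c])
qed

section \<open>Linear combinations of fields with constant coefficients\<close>

lemma vf_loc_add: "vf_loc \<A> c (\<lambda>q. X q + Y q) = (\<lambda>x. vf_loc \<A> c X x + vf_loc \<A> c Y x)"
  by (auto simp: vf_loc_def blinfun.bilinear_simps)

lemma vf_loc_scaleR: "vf_loc \<A> c (\<lambda>q. r *\<^sub>R X q) = (\<lambda>x. r *\<^sub>R vf_loc \<A> c X x)"
  by (auto simp: vf_loc_def blinfun.bilinear_simps)

lemma form1_loc_add: "form1_loc \<A> c (\<lambda>q. \<alpha> q + \<beta> q) = (\<lambda>x. form1_loc \<A> c \<alpha> x + form1_loc \<A> c \<beta> x)"
  by (auto simp: form1_loc_def bounded_bilinear.add_left[OF bounded_bilinear_blinfun_compose])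

lemma form1_loc_scaleR: "form1_loc \<A> c (\<lambda>q. r *\<^sub>R \<alpha> q) = (\<lambda>x. r *\<^sub>R form1_loc \<A> c \<alpha> x)"
  by (auto simp: form1_loc_def bounded_bilinear.scaleR_left[OF bounded_bilinear_blinfun_compose])

lemma vector_field_add: "vector_field \<A> X \<Longrightarrow> vector_field \<A> Y \<Longrightarrow> vector_field \<A> (\<lambda>q. X q + Y q)"
  by (simp add: vector_field_def vf_loc_add smooth_on_add open_img)

lemma vector_field_scaleR: "vector_field \<A> X \<Longrightarrow> vector_field \<A> (\<lambda>q. r *\<^sub>R X q)"
  by (simp add: vector_field_def vf_loc_scaleR smooth_on_linear[OF open_img bounded_linear_scaleR_right])

lemma one_form_add: "one_form \<A> \<alpha> \<Longrightarrow> one_form \<A> \<beta> \<Longrightarrow> one_form \<A> (\<lambda>q. \<alpha> q + \<beta> q)"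
  by (simp add: one_form_def form1_loc_add smooth_on_add open_img)

lemma one_form_scaleR: "one_form \<A> \<alpha> \<Longrightarrow> one_form \<A> (\<lambda>q. r *\<^sub>R \<alpha> q)"
  by (simp add: one_form_def form1_loc_scaleR smooth_on_linear[OF open_img bounded_linear_scaleR_right])

lemma one_form_zero: "one_form \<A> (\<lambda>q. 0)"
proof -
  have "form1_loc \<A> c (\<lambda>q. 0) = (\<lambda>x. 0)" for c
    by (auto intro!: blinfun_eqI simp: form1_loc_def)
  then show ?thesis by (simp add: one_form_def smooth_on_const open_img)
qed

end

section \<open>First derivatives at a point\<close>

context atlas
begin

text \<open>Like \<open>jac\<close>, this is a partial derivative of components in the preferred
  chart and not a tensor. Here and in \<open>dend\<close> and \<open>dform2\<close> the first vector
  argument is the direction of differentiation.\<close>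

definition dform :: "('m, 'e) form1 \<Rightarrow> 'm \<Rightarrow> 'e \<Rightarrow> 'e covector" where
  "dform \<alpha> p = frechet_derivative (form1_loc \<A> (pref_chart \<A> p) \<alpha>) (at (pref_crd \<A> p))"

definition dend :: "('m, 'e) endfield \<Rightarrow> 'm \<Rightarrow> 'e \<Rightarrow> 'e \<Rightarrow>\<^sub>L 'e" where
  "dend A p = frechet_derivative (end_loc \<A> (pref_chart \<A> p) A) (at (pref_crd \<A> p))"

definition dform2 :: "('m, 'e) form2 \<Rightarrow> 'm \<Rightarrow> 'e \<Rightarrow> 'e \<Rightarrow>\<^sub>L 'e covector" where
  "dform2 \<sigma> p = frechet_derivative (form2_blin (pref_chart \<A> p) \<sigma>) (at (pref_crd \<A> p))"

lemma vf_loc_pref: "vf_loc \<A> (pref_chart \<A> p) X (pref_crd \<A> p) = X p"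
  by (simp add: vf_loc_def pt_pref_crd pref_chart_id)

lemma form1_loc_pref: "form1_loc \<A> (pref_chart \<A> p) \<alpha> (pref_crd \<A> p) = \<alpha> p"
  by (auto intro!: blinfun_eqI simp: form1_loc_def pt_pref_crd pref_chart_id)

lemma end_loc_pref: "end_loc \<A> (pref_chart \<A> p) A (pref_crd \<A> p) = A p"
  by (auto intro!: blinfun_eqI simp: end_loc_def pt_pref_crd pref_chart_id)

lemma form2_blin_pref: "form2_blin (pref_chart \<A> p) \<sigma> (pref_crd \<A> p) = \<sigma> p"
  by (auto intro!: blinfun_eqI simp: form2_blin_apply form2_loc_def pt_pref_crd pref_chart_id)

section \<open>Differentiability of the components at the base point\<close>

lemma vf_has_derivative:
  assumes "vector_field \<A> X"
  shows "(vf_loc \<A> (pref_chart \<A> p) X has_derivative jac \<A> X p) (at (pref_crd \<A> p))"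
proof -
  have "(vf_loc \<A> (pref_chart \<A> p) X has_derivative
      frechet_derivative (vf_loc \<A> (pref_chart \<A> p) X) (at (pref_crd \<A> p))) (at (pref_crd \<A> p))"
    using assms pref_chart(1) pref_crd_in unfolding vector_field_def
    by (intro smooth_on_has_derivative) auto
  then show ?thesis
    by (simp add: jac_def bounded_linear_Blinfun_apply[OF has_derivative_bounded_linear])
qed

lemma form1_has_derivative:
  assumes "one_form \<A> \<alpha>"
  shows "(form1_loc \<A> (pref_chart \<A> p) \<alpha> has_derivative dform \<alpha> p) (at (pref_crd \<A> p))"
  using assms pref_chart(1) pref_crd_in unfolding one_form_def dform_def
  by (intro smooth_on_has_derivative) auto

lemma dform_arg:
  assumes "one_form \<A> \<alpha>"
  shows "dform \<alpha> p (u + v) = dform \<alpha> p u + dform \<alpha> p v" "dform \<alpha> p (r *\<^sub>R u) = r *\<^sub>R dform \<alpha> p u"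
  using has_derivative_linear[OF form1_has_derivative[OF assms]]
  by (simp_all add: linear_add linear_scale)

lemma end_has_derivative:
  assumes "end_field \<A> A"
  shows "(end_loc \<A> (pref_chart \<A> p) A has_derivative dend A p) (at (pref_crd \<A> p))"
  using assms pref_chart(1) pref_crd_in unfolding end_field_def dend_def
  by (intro smooth_on_has_derivative) auto

lemma form2_has_derivative:
  assumes "two_form \<A> \<sigma>"
  shows "(form2_blin (pref_chart \<A> p) \<sigma> has_derivative dform2 \<sigma> p) (at (pref_crd \<A> p))"
  unfolding dform2_def
  by (rule smooth_on_has_derivative[OF smooth_form2_blin[OF pref_chart(1) assms] pref_crd_in])

text \<open>Component identities hold only on the image of the chart; since this image is open
  around \<open>pref_crd \<A> p\<close>, they may still be differentiated there.\<close>

lemma has_derivative_local: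
  assumes "(f has_derivative D) (at (pref_crd \<A> p))"
    and "\<And>x. x \<in> img_ch (pref_chart \<A> p) \<Longrightarrow> f x = g x"
  shows "(g has_derivative D) (at (pref_crd \<A> p))"
  by (rule has_derivative_transform_within_open[OF assms(1) open_img[OF pref_chart(1)] pref_crd_in])
    (fact assms(2))

lemma jac_eqI:
  assumes "(vf_loc \<A> (pref_chart \<A> p) X has_derivative D) (at (pref_crd \<A> p))"
  shows "jac \<A> X p u = D u"
  using assms frechet_derivative_at[OF assms]
  by (simp add: jac_def bounded_linear_Blinfun_apply[OF has_derivative_bounded_linear])

lemma dform_eqI:
  assumes "(form1_loc \<A> (pref_chart \<A> p) \<alpha> has_derivative D) (at (pref_crd \<A> p))"
  shows "dform \<alpha> p u = D u"
  using frechet_derivative_at[OF assms] by (simp add: dform_def)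

lemma differential_eqI:
  assumes "((\<lambda>x. f (pt (pref_chart \<A> p) x)) has_derivative D) (at (pref_crd \<A> p))"
  shows "differential \<A> f p u = D u"
  using assms frechet_derivative_at[OF assms]
  by (simp add: differential_def comp_def bounded_linear_Blinfun_apply[OF has_derivative_bounded_linear])

section \<open>Linearity and product rules for first derivatives\<close>

lemma jac_add:
  assumes "vector_field \<A> X" "vector_field \<A> Y"
  shows "jac \<A> (\<lambda>q. X q + Y q) p u = jac \<A> X p u + jac \<A> Y p u"
  by (rule jac_eqI) (simp add: vf_loc_add has_derivative_add vf_has_derivative assms)

lemma jac_scaleR:
  assumes "vector_field \<A> X"
  shows "jac \<A> (\<lambda>q. r *\<^sub>R X q) p u = r *\<^sub>R jac \<A> X p u"
  by (rule jac_eqI) (simp add: vf_loc_scaleR has_derivative_scaleR_right vf_has_derivative assms)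

lemma dform_add:
  assumes "one_form \<A> \<alpha>" "one_form \<A> \<beta>"
  shows "dform (\<lambda>q. \<alpha> q + \<beta> q) p u = dform \<alpha> p u + dform \<beta> p u"
  by (rule dform_eqI) (simp add: form1_loc_add has_derivative_add form1_has_derivative assms)

lemma dform_scaleR:
  assumes "one_form \<A> \<alpha>"
  shows "dform (\<lambda>q. r *\<^sub>R \<alpha> q) p u = r *\<^sub>R dform \<alpha> p u"
  by (rule dform_eqI) (simp add: form1_loc_scaleR has_derivative_scaleR_right form1_has_derivative assms)

lemma dform_zero: "dform (\<lambda>q. 0) p u = 0"
  using dform_scaleR[OF one_form_zero, of 0 p u] by simp

lemma jac_end:
  fixes A :: "('m, 'e) endfield"
  assumes "end_field \<A> A" "vector_field \<A> X"
  shows "jac \<A> (\<lambda>q. A q (X q)) p u = dend A p u (X p) + A p (jac \<A> X p u)"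
proof (rule jac_eqI[OF has_derivative_local])
  show "((\<lambda>x. end_loc \<A> (pref_chart \<A> p) A x (vf_loc \<A> (pref_chart \<A> p) X x)) has_derivative
    (\<lambda>u. dend A p u (X p) + A p (jac \<A> X p u))) (at (pref_crd \<A> p))"
    using bounded_bilinear.FDERIV[OF bounded_bilinear_blinfun_apply
        end_has_derivative[OF assms(1), of p] vf_has_derivative[OF assms(2), of p]]
    by (simp add: vf_loc_pref end_loc_pref add.commute)
qed (simp add: vf_loc_end pref_chart)

lemma dform_flat:
  assumes "two_form \<A> \<sigma>" "vector_field \<A> X"
  shows "dform (\<lambda>q. flat (\<sigma> q) (X q)) p u = dform2 \<sigma> p u (X p) + \<sigma> p (jac \<A> X p u)"
proof (rule dform_eqI[OF has_derivative_local])
  show "((\<lambda>x. form2_blin (pref_chart \<A> p) \<sigma> x (vf_loc \<A> (pref_chart \<A> p) X x)) has_derivative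
    (\<lambda>u. dform2 \<sigma> p u (X p) + \<sigma> p (jac \<A> X p u))) (at (pref_crd \<A> p))"
    using bounded_bilinear.FDERIV[OF bounded_bilinear_blinfun_apply
        form2_has_derivative[OF assms(1), of p] vf_has_derivative[OF assms(2), of p]]
    by (simp add: vf_loc_pref form2_blin_pref add.commute)
qed (simp add: form1_loc_flat pref_chart)

lemma pairing_has_derivative:
  fixes \<alpha> :: "('m, 'e) form1"
  assumes "one_form \<A> \<alpha>" "vector_field \<A> X"
  shows "((\<lambda>x. \<alpha> (pt (pref_chart \<A> p) x) (X (pt (pref_chart \<A> p) x))) has_derivative
    (\<lambda>u. dform \<alpha> p u (X p) + \<alpha> p (jac \<A> X p u))) (at (pref_crd \<A> p))"
proof (rule has_derivative_local)
  show "((\<lambda>x. form1_loc \<A> (pref_chart \<A> p) \<alpha> x (vf_loc \<A> (pref_chart \<A> p) X x)) has_derivative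
    (\<lambda>u. dform \<alpha> p u (X p) + \<alpha> p (jac \<A> X p u))) (at (pref_crd \<A> p))"
    using bounded_bilinear.FDERIV[OF bounded_bilinear_blinfun_apply
        form1_has_derivative[OF assms(1), of p] vf_has_derivative[OF assms(2), of p]]
    by (simp add: vf_loc_pref form1_loc_pref add.commute)
qed (simp add: pairing_loc pref_chart)

lemma differential_pairing:
  fixes \<alpha> :: "('m, 'e) form1"
  assumes "one_form \<A> \<alpha>" "vector_field \<A> X"
  shows "differential \<A> (\<lambda>q. \<alpha> q (X q)) p u = dform \<alpha> p u (X p) + \<alpha> p (jac \<A> X p u)"
  by (rule differential_eqI) (rule pairing_has_derivative[OF assms])

section \<open>The Courant bracket in coordinates\<close>

lemma courant_fst:
  "fst (courant \<A> S T p) =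
    jac \<A> (\<lambda>q. fst (T q)) p (fst (S p)) - jac \<A> (\<lambda>q. fst (S q)) p (fst (T p))"
  by (simp add: courant_def lie_bracket_def Let_def comp_def)

lemma big_sectionD:
  assumes "big_section \<A> S"
  shows "vector_field \<A> (\<lambda>q. fst (S q))" "one_form \<A> (\<lambda>q. snd (S q))"
  using assms by (simp_all add: big_section_def comp_def)

lemma big_sectionI:
  "vector_field \<A> X \<Longrightarrow> one_form \<A> \<alpha> \<Longrightarrow> big_section \<A> (\<lambda>q. (X q, \<alpha> q))"
  by (simp add: big_section_def comp_def)

text \<open>The product rule for the pairings expands the bracket into values and first derivatives
  at \<open>p\<close>. Skew-symmetry, linearity over constants and the torsion computations thereby
  become pointwise algebra.\<close>

lemma courant_snd:
  assumes "big_section \<A> S" "big_section \<A> T"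
  defines "X \<equiv> \<lambda>q. fst (S q)" and "\<alpha> \<equiv> \<lambda>q. snd (S q)"
    and "Y \<equiv> \<lambda>q. fst (T q)" and "\<beta> \<equiv> \<lambda>q. snd (T q)"
  shows "snd (courant \<A> S T p) v =
    dform \<beta> p (X p) v + \<beta> p (jac \<A> X p v) - dform \<alpha> p (Y p) v - \<alpha> p (jac \<A> Y p v)
    + (dform \<alpha> p v (Y p) + \<alpha> p (jac \<A> Y p v) - dform \<beta> p v (X p) - \<beta> p (jac \<A> X p v)) / 2"
proof -
  note * = big_sectionD[OF assms(1), folded X_def \<alpha>_def] big_sectionD[OF assms(2), folded Y_def \<beta>_def]
  have "differential \<A> (\<lambda>q. \<alpha> q (Y q) - \<beta> q (X q)) p v =
      (dform \<alpha> p v (Y p) + \<alpha> p (jac \<A> Y p v)) - (dform \<beta> p v (X p) + \<beta> p (jac \<A> X p v))"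
    by (rule differential_eqI) (intro has_derivative_diff pairing_has_derivative *)
  then show ?thesis
    unfolding courant_def Let_def comp_def lie_form1_def
      dform_def[symmetric] X_def[symmetric] Y_def[symmetric] \<alpha>_def[symmetric] \<beta>_def[symmetric]
    by (simp add: blinfun.bilinear_simps)
qed

lemma big_section_add:
  "big_section \<A> S \<Longrightarrow> big_section \<A> T \<Longrightarrow> big_section \<A> (\<lambda>q. S q + T q)"
  by (simp add: big_section_def comp_def vector_field_add one_form_add)

lemma big_section_scaleR: "big_section \<A> S \<Longrightarrow> big_section \<A> (\<lambda>q. r *\<^sub>R S q)"
  by (simp add: big_section_def comp_def vector_field_scaleR one_form_scaleR)

lemma courant_antisym:
  assumes "big_section \<A> S" "big_section \<A> T"
  shows "courant \<A> T S p = - courant \<A> S T p"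
  by (rule prod_eqI)
    (auto intro!: blinfun_eqI simp: courant_fst courant_snd assms blinfun.bilinear_simps field_simps)

lemma courant_add_left:
  assumes "big_section \<A> S" "big_section \<A> S'" "big_section \<A> T"
  shows "courant \<A> (\<lambda>q. S q + S' q) T p = courant \<A> S T p + courant \<A> S' T p"
  using assms
  by (intro prod_eqI)
    (auto intro!: blinfun_eqI simp: courant_fst courant_snd big_section_add big_sectionD
      jac_add dform_add dform_arg blinfun.bilinear_simps field_simps)

lemma courant_scaleR_left:
  assumes "big_section \<A> S" "big_section \<A> T"
  shows "courant \<A> (\<lambda>q. r *\<^sub>R S q) T p = r *\<^sub>R courant \<A> S T p"
  using assms
  by (intro prod_eqI)
    (auto intro!: blinfun_eqI simp: courant_fst courant_snd big_section_scaleR big_sectionD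
      jac_scaleR dform_scaleR dform_arg blinfun.bilinear_simps field_simps)

lemma courant_add_right:
  assumes "big_section \<A> S" "big_section \<A> T" "big_section \<A> T'"
  shows "courant \<A> S (\<lambda>q. T q + T' q) p = courant \<A> S T p + courant \<A> S T' p"
  using courant_antisym[OF big_section_add[OF assms(2,3)] assms(1), of p]
    courant_antisym[OF assms(2,1), of p] courant_antisym[OF assms(3,1), of p]
    courant_add_left[OF assms(2,3,1), of p] by simp

lemma courant_scaleR_right:
  assumes "big_section \<A> S" "big_section \<A> T"
  shows "courant \<A> S (\<lambda>q. r *\<^sub>R T q) p = r *\<^sub>R courant \<A> S T p"
  using courant_antisym[OF big_section_scaleR[OF assms(2)] assms(1), of r p]
    courant_antisym[OF assms(2,1), of p] courant_scaleR_left[OF assms(2,1), of r p] by simp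

section \<open>First derivatives of the 2-form: exterior derivative, skewness, compatibility\<close>

lemma ext_deriv2_dform2:
  assumes "two_form \<A> \<sigma>"
  shows "ext_deriv2 \<A> \<sigma> p u v w = dform2 \<sigma> p u v w + dform2 \<sigma> p v w u + dform2 \<sigma> p w u v"
proof -
  have "frechet_derivative (\<lambda>x. form2_loc \<A> (pref_chart \<A> p) \<sigma> x a b) (at (pref_crd \<A> p)) u 
     = dform2 \<sigma> p u a b" for a b u
  proof -
    have "((\<lambda>x. form2_blin (pref_chart \<A> p) \<sigma> x a b) has_derivative (\<lambda>u. dform2 \<sigma> p u a b)) (at (pref_crd \<A> p))"
      by (intro bounded_linear.has_derivative[OF blinfun.bounded_linear_left] form2_has_derivative assms)
    then show ?thesis
      unfolding form2_blin_apply by (simp add: frechet_derivative_at[symmetric])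
  qed
  then show ?thesis by (simp add: ext_deriv2_def Let_def)
qed

lemma dform2_skew:
  assumes "two_form \<A> \<sigma>"
  shows "dform2 \<sigma> p u v w = - dform2 \<sigma> p u w v"
proof -
  have d: "((\<lambda>x. form2_blin (pref_chart \<A> p) \<sigma> x a b) has_derivative (\<lambda>u. dform2 \<sigma> p u a b)) (at (pref_crd \<A> p))" for a b
    by (intro bounded_linear.has_derivative[OF blinfun.bounded_linear_left] form2_has_derivative assms)
  have eq: "form2_blin (pref_chart \<A> p) \<sigma> x v w = - form2_blin (pref_chart \<A> p) \<sigma> x w v" for x
    using assms unfolding form2_blin_apply form2_loc_def two_form_def by blast
  have "((\<lambda>x. form2_blin (pref_chart \<A> p) \<sigma> x v w) has_derivative (\<lambda>u. - dform2 \<sigma> p u w v)) (at (pref_crd \<A> p))"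
    unfolding eq by (intro has_derivative_minus d)
  from has_derivative_unique[OF d this] show ?thesis by (rule fun_cong)
qed

text \<open>The relation \<open>compat\<close> holds at all points of the chart, so it may be
  differentiated in the direction \<open>z\<close>: the product rule applied to either side gives
  the two sides here.\<close>

lemma dform2_compatible:
  fixes A :: "('m, 'e) endfield"
  assumes \<sigma>: "two_form \<A> \<sigma>" and A: "end_field \<A> A"
    and compat: "\<And>q u v. \<sigma> q (A q u) v = \<sigma> q u (A q v)"
  shows "dform2 \<sigma> p z (A p u) v + \<sigma> p (dend A p z u) v = dform2 \<sigma> p z u (A p v) + \<sigma> p u (dend A p z v)"
proof -
  let ?c = "pref_chart \<A> p" and ?x = "pref_crd \<A> p"
  let ?B = "form2_blin ?c \<sigma>" and ?A = "end_loc \<A> ?c A"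
  note dB = form2_has_derivative[OF \<sigma>, of p]
  have dA: "((\<lambda>x. ?A x w) has_derivative (\<lambda>z. dend A p z w)) (at ?x)" for w
    by (intro bounded_linear.has_derivative[OF blinfun.bounded_linear_left] end_has_derivative A)
  have 1: "((\<lambda>x. ?B x (?A x u) v) has_derivative (\<lambda>z. \<sigma> p (dend A p z u) v + dform2 \<sigma> p z (A p u) v)) (at ?x)"
    using bounded_linear.has_derivative[OF blinfun.bounded_linear_left
        bounded_bilinear.FDERIV[OF bounded_bilinear_blinfun_apply dB dA[of u]], of v]
    by (simp add: form2_blin_pref end_loc_pref blinfun.bilinear_simps)
  have 2: "((\<lambda>x. ?B x u (?A x v)) has_derivative (\<lambda>z. \<sigma> p u (dend A p z v) + dform2 \<sigma> p z u (A p v))) (at ?x)"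
    using bounded_bilinear.FDERIV[OF bounded_bilinear_blinfun_apply
        bounded_linear.has_derivative[OF blinfun.bounded_linear_left dB, of u] dA[of v]]
    by (simp add: form2_blin_pref end_loc_pref)
  have "((\<lambda>x. ?B x (?A x u) v) has_derivative (\<lambda>z. \<sigma> p u (dend A p z v) + dform2 \<sigma> p z u (A p v))) (at ?x)"
  proof (rule has_derivative_local[OF 2])
    fix x assume "x \<in> img_ch ?c"
    then show "?B x u (?A x v) = ?B x (?A x u) v"
      using to_from_chart(2)[OF pref_chart(1) pt_in[OF pref_chart(1)], of x p]
      by (simp add: form2_blin_apply form2_loc_def end_loc_def compat)
  qed
  from fun_cong[OF has_derivative_unique[OF 1 this], of z] show ?thesis by simp
qed

end

section \<open>The inverse bivector field\<close>

context atlas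
begin

text \<open>Every covector is \<open>flat\<close> of a vector, in components \<open>W \<xi>\<close>,
  so the relation between \<open>sharp\<close> and \<open>flat\<close> determines \<open>w\<close>:
  it is minus the inverse matrix of the 2-form.\<close>

lemma biv_loc_inverse:
  assumes "c \<in> \<A>" "x \<in> img_ch c" and w: "\<And>p v. sharp (w p) (flat (\<sigma> p) v) = - v"
    and W: "form2_blin c \<sigma> x o\<^sub>L W = id_blinfun"
  shows "biv_loc \<A> c w x \<xi> \<eta> = - \<eta> (W \<xi>)"
proof -
  let ?q = "pt c x"
  let ?u = "W \<xi>"
  have "form2_blin c \<sigma> x ?u = \<xi>"
    using W by (metis blinfun_apply_blinfun_compose blinfun_apply_id_blinfun)
  then have "\<xi> (to_chart \<A> c ?q v) = \<sigma> ?q (from_chart \<A> c ?q ?u) v" for v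
    using form2_blin_apply[of c \<sigma> x ?u "to_chart \<A> c ?q v"]
      to_from_chart(2)[OF assms(1) pt_in[OF assms(1,2)]]
    by (simp add: form2_loc_def)
  then have \<xi>: "\<xi> o\<^sub>L to_chart \<A> c ?q = flat (\<sigma> ?q) (from_chart \<A> c ?q ?u)"
    by (auto intro!: blinfun_eqI simp: flat_def)
  show ?thesis
    using to_from_chart(1)[OF assms(1) pt_in[OF assms(1,2)]]
    by (simp add: biv_loc_def \<xi> w blinfun.bilinear_simps flip: covector_sharp)
qed

text \<open>Nondegeneracy at the point passes to the components because the Jacobian is invertible;
  the pointwise inverses are then collected into a function.\<close>

lemma form2_blin_inverse:
  assumes "symplectic \<A> \<sigma>" "c \<in> \<A>"
  obtains W where "\<And>x. x \<in> img_ch c \<Longrightarrow> W x o\<^sub>L form2_blin c \<sigma> x = id_blinfun"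
    "\<And>x. x \<in> img_ch c \<Longrightarrow> form2_blin c \<sigma> x o\<^sub>L W x = id_blinfun"
proof -
  have "\<exists>r. r o\<^sub>L form2_blin c \<sigma> x = id_blinfun \<and> form2_blin c \<sigma> x o\<^sub>L r = id_blinfun"
    if x: "x \<in> img_ch c" for x
  proof (rule nondegenerate_inverse[of "form2_blin c \<sigma> x"])
    fix u assume u: "\<And>v. form2_blin c \<sigma> x u v = 0"
    let ?q = "pt c x"
    note tf = to_from_chart(1,2)[OF assms(2) pt_in[OF assms(2) x]]
    have "\<sigma> ?q (from_chart \<A> c ?q u) v = 0" for v
      using u[of "to_chart \<A> c ?q v"] by (simp add: form2_blin_apply form2_loc_def tf)
    then have "from_chart \<A> c ?q u = 0"
      using assms(1) unfolding symplectic_def by blast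
    then show "u = 0" using tf(1)[of u] by simp
  qed blast
  then show thesis using that by metis
qed

text \<open>The components of \<open>w\<close> are those of minus the inverse matrix of the 2-form,
  and inversion preserves smoothness.\<close>

lemma bivector_field_inverse:
  assumes "symplectic \<A> \<sigma>" and w: "\<And>p v. sharp (w p) (flat (\<sigma> p) v) = - v"
    and skew: "\<And>p \<xi> \<eta>. w p \<xi> \<eta> = - w p \<eta> \<xi>"
  shows "bivector_field \<A> w"
  unfolding bivector_field_def
proof (intro conjI allI ballI)
  fix c and \<xi> \<eta> :: "'e covector" assume c: "c \<in> \<A>"
  have \<sigma>: "two_form \<A> \<sigma>" using assms(1) by (simp add: symplectic_def)
  obtain W where W: "\<And>x. x \<in> img_ch c \<Longrightarrow> W x o\<^sub>L form2_blin c \<sigma> x = id_blinfun"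
    "\<And>x. x \<in> img_ch c \<Longrightarrow> form2_blin c \<sigma> x o\<^sub>L W x = id_blinfun"
    using form2_blin_inverse[OF assms(1) c] by blast
  have "smooth_on (img_ch c) W"
    by (rule smooth_on_inverse[OF open_img[OF c] smooth_form2_blin[OF c \<sigma>] W])
  then have "smooth_on (img_ch c) (\<lambda>x. - \<eta> (W x \<xi>))"
    by (intro smooth_on_linear[OF open_img[OF c], of "\<lambda>T::'e covector \<Rightarrow>\<^sub>L 'e. - \<eta> (T \<xi>)"] bounded_linear_intros
        bounded_linear_minus)
  then show "smooth_on (img_ch c) (\<lambda>x. biv_loc \<A> c w x \<xi> \<eta>)"
    by (rule smooth_on_cong[OF open_img[OF c]]) (simp add: biv_loc_inverse[OF c _ w W(2)])
qed (fact skew)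

text \<open>Differentiating the inverse matrix expresses the derivative of \<open>w\<close> through
  that of the 2-form. The cyclic sum in \<open>schouten\<close> then becomes twice the exterior
  derivative evaluated at \<open>W ?x \<xi>\<close>, \<open>W ?x \<eta>\<close>,
  \<open>W ?x \<zeta>\<close>.\<close>

lemma schouten_inverse:
  assumes "symplectic \<A> \<sigma>" and w: "\<And>p v. sharp (w p) (flat (\<sigma> p) v) = - v"
  shows "schouten \<A> w w p \<xi> \<eta> \<zeta> = 0"
proof -
  let ?c = "pref_chart \<A> p" and ?x = "pref_crd \<A> p"
  note c = pref_chart(1)[of p]
  have \<sigma>: "two_form \<A> \<sigma>" using assms(1) by (simp add: symplectic_def)
  have skew: "\<sigma> q u v = - \<sigma> q v u" for q u v using \<sigma> unfolding two_form_def by blast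
  obtain W where W: "\<And>x. x \<in> img_ch ?c \<Longrightarrow> W x o\<^sub>L form2_blin ?c \<sigma> x = id_blinfun"
    "\<And>x. x \<in> img_ch ?c \<Longrightarrow> form2_blin ?c \<sigma> x o\<^sub>L W x = id_blinfun"
    using form2_blin_inverse[OF assms(1) c] by blast
  have \<sigma>W: "\<sigma> p (W ?x \<xi>) = \<xi>" for \<xi>
    using W(2)[OF pref_crd_in] unfolding form2_blin_pref
    by (metis blinfun_apply_blinfun_compose blinfun_apply_id_blinfun)
  have sharp: "sharp (w p) \<xi> = - W ?x \<xi>" for \<xi>
    using w[of p "W ?x \<xi>"] by (simp add: flat_def \<sigma>W)
  have D: "frechet_derivative (\<lambda>x. biv_loc \<A> ?c w x \<alpha> \<beta>) (at ?x) u =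
      - dform2 \<sigma> p u (W ?x \<alpha>) (W ?x \<beta>)" for \<alpha> \<beta> u
  proof -
    have "(W has_derivative (\<lambda>u. - (W ?x o\<^sub>L dform2 \<sigma> p u o\<^sub>L W ?x))) (at ?x)"
      by (rule inverse_has_derivative[OF open_img[OF c] pref_crd_in form2_has_derivative[OF \<sigma>] W])
    then have "((\<lambda>x. - \<beta> (W x \<alpha>)) has_derivative
        (\<lambda>u. - \<beta> ((- (W ?x o\<^sub>L dform2 \<sigma> p u o\<^sub>L W ?x)) \<alpha>))) (at ?x)"
      by (intro has_derivative_minus bounded_linear.has_derivative[OF blinfun.bounded_linear_right]
          bounded_linear.has_derivative[OF blinfun.bounded_linear_left])
    then have "((\<lambda>x. biv_loc \<A> ?c w x \<alpha> \<beta>) has_derivative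
        (\<lambda>u. - \<beta> ((- (W ?x o\<^sub>L dform2 \<sigma> p u o\<^sub>L W ?x)) \<alpha>))) (at ?x)"
      by (rule has_derivative_local) (simp add: biv_loc_inverse[OF c _ w W(2)])
    from fun_cong[OF frechet_derivative_at[OF this], of u]
    have "frechet_derivative (\<lambda>x. biv_loc \<A> ?c w x \<alpha> \<beta>) (at ?x) u
        = \<beta> (W ?x (dform2 \<sigma> p u (W ?x \<alpha>)))"
      by (simp add: blinfun.bilinear_simps)
    \<comment> \<open>Writing \<open>\<beta>\<close> as the 2-form contracted with
      \<open>W ?x \<beta>\<close> and then exchanging the arguments lets \<open>\<sigma> p\<close>
      cancel the outer inverse.\<close>
    also have "\<dots> = \<sigma> p (W ?x \<beta>) (W ?x (dform2 \<sigma> p u (W ?x \<alpha>)))" by (simp add: \<sigma>W)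
    also have "\<dots> = - \<sigma> p (W ?x (dform2 \<sigma> p u (W ?x \<alpha>))) (W ?x \<beta>)" by (rule skew)
    finally show ?thesis by (simp add: \<sigma>W)
  qed
  have lin: "dform2 \<sigma> p (- u) = - dform2 \<sigma> p u" for u
    using linear_neg[OF has_derivative_linear[OF form2_has_derivative[OF \<sigma>, of p]]] .
  have "ext_deriv2 \<A> \<sigma> p (W ?x \<xi>) (W ?x \<eta>) (W ?x \<zeta>) = 0"
    using assms(1) unfolding symplectic_def by blast
  then show ?thesis
    unfolding schouten_def Let_def D sharp lin ext_deriv2_dform2[OF \<sigma>]
    by (simp add: blinfun.bilinear_simps)
qed

lemma flat_inverse:
  assumes "symplectic \<A> \<sigma>"
  obtains r where "\<And>p v. blinfun_apply (r p) (flat (\<sigma> p) v) = v" "\<And>p \<xi>. flat (\<sigma> p) (blinfun_apply (r p) \<xi>) = \<xi>"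
proof -
  have "\<exists>r. r o\<^sub>L \<sigma> p = id_blinfun \<and> \<sigma> p o\<^sub>L r = id_blinfun" for p
  proof (rule nondegenerate_inverse[of "\<sigma> p"])
    show "u = 0" if "\<And>v. \<sigma> p u v = 0" for u
      using assms that unfolding symplectic_def by blast
  qed blast
  then obtain r where r: "\<And>p. r p o\<^sub>L \<sigma> p = id_blinfun" "\<And>p. \<sigma> p o\<^sub>L r p = id_blinfun"
    by metis
  show thesis
  proof
    show "r p (flat (\<sigma> p) v) = v" for p v
      using r(1) unfolding flat_def by (metis blinfun_apply_blinfun_compose blinfun_apply_id_blinfun)
    show "flat (\<sigma> p) (r p \<xi>) = \<xi>" for p \<xi>
      using r(2) unfolding flat_def by (metis blinfun_apply_blinfun_compose blinfun_apply_id_blinfun)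
  qed
qed

lemma inverse_bivector_exists:
  assumes "symplectic \<A> \<sigma>"
  obtains w where "bivector_field \<A> w" "\<And>p v. sharp (w p) (flat (\<sigma> p) v) = - v"
proof -
  have skew: "\<sigma> q u v = - \<sigma> q v u" for q u v
    using assms unfolding symplectic_def two_form_def by blast
  obtain r where r\<sigma>: "\<And>p v. blinfun_apply (r p) (flat (\<sigma> p) v) = v"
    and \<sigma>r: "\<And>p \<xi>. flat (\<sigma> p) (blinfun_apply (r p) \<xi>) = \<xi>"
    using flat_inverse[OF assms] by blast
  \<comment> \<open>\<open>blinfun.prod_left\<close> sends a vector to evaluation at it, so
    \<open>w p \<xi>\<close> is minus evaluation at \<open>r p \<xi>\<close>. The sign is the one in
    \<open>sharp (w p) (flat (\<sigma> p) v) = - v\<close>.\<close>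
  define w :: "('m, 'e) bivfield" where "w p = - (Blinfun blinfun.prod_left o\<^sub>L r p)" for p
  have w: "w p \<xi> \<eta> = - \<eta> (r p \<xi>)" for p \<xi> \<eta>
    by (simp add: w_def blinfun.bilinear_simps bounded_linear_Blinfun_apply
        blinfun.bounded_linear_prod_left blinfun.prod_left.rep_eq)
  have sharp: "sharp (w p) (flat (\<sigma> p) v) = - v" for p v
    by (rule sharp_eqI) (simp add: w r\<sigma> blinfun.bilinear_simps)
  moreover have "w p \<xi> \<eta> = - w p \<eta> \<xi>" for p \<xi> \<eta>
    using skew[of p "r p \<eta>" "r p \<xi>"] by (simp add: w \<sigma>r flip: flat_def)
  ultimately show thesis using bivector_field_inverse[OF assms] that by blast
qed

section \<open>The Courant-Nijenhuis torsion and its reduction to vector fields\<close>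

definition torsion :: "('m, 'e) bigend \<Rightarrow> ('m, 'e) bigsection \<Rightarrow> ('m, 'e) bigsection \<Rightarrow> ('m, 'e) bigsection" where
  "torsion \<Phi> S T p = courant \<A> (\<lambda>q. \<Phi> q (S q)) (\<lambda>q. \<Phi> q (T q)) p
     - \<Phi> p (courant \<A> S (\<lambda>q. \<Phi> q (T q)) p) - \<Phi> p (courant \<A> (\<lambda>q. \<Phi> q (S q)) T p)
     + \<Phi> p (\<Phi> p (courant \<A> S T p))"

lemma gen_integrable_iff_torsion:
  "gen_integrable \<A> \<Phi> \<longleftrightarrow>
    (\<forall>S T. big_section \<A> S \<longrightarrow> big_section \<A> T \<longrightarrow> (\<forall>p. torsion \<Phi> S T p = 0))"
  by (simp add: gen_integrable_def torsion_def Let_def)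

end

locale symplectic_cps = atlas \<A>
  for \<A> :: "('m::{t2_space,second_countable_topology}, 'e::euclidean_space) chart set" +
  fixes \<epsilon> :: real and \<Phi> :: "('m, 'e) bigend" and A :: "('m, 'e) endfield"
    and \<pi> :: "('m, 'e) bivfield" and \<sigma> :: "('m, 'e) form2"
  assumes cps: "gen_almost_cps \<A> \<epsilon> \<Phi>"
    and tensors: "classical_tensor_fields \<A> \<Phi> A \<pi> \<sigma>"
    and symp: "symplectic \<A> \<sigma>"
begin

lemma A_field: "end_field \<A> A" and \<pi>_field: "bivector_field \<A> \<pi>" and \<sigma>_form: "two_form \<A> \<sigma>"
  and \<Phi>_eq: "\<Phi> p (v, \<alpha>) = (A p v + sharp (\<pi> p) \<alpha>, flat (\<sigma> p) v - (\<alpha> o\<^sub>L A p))"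
  using tensors by (simp_all add: classical_tensor_fields_def)

lemma \<Phi>_square: "\<Phi> p (\<Phi> p x) = \<epsilon> *\<^sub>R x"
  using cps unfolding gen_almost_cps_def by blast

lemma \<sigma>_skew: "\<sigma> p u v = - \<sigma> p v u"
  using \<sigma>_form unfolding two_form_def by blast

lemma \<Phi>_vector: "\<Phi> p (v, 0) = (A p v, flat (\<sigma> p) v)"
  by (simp add: \<Phi>_eq sharp_zero bounded_bilinear.zero_left[OF bounded_bilinear_blinfun_compose])

text \<open>The form part and the vector part of
  \<open>\<Phi> p (\<Phi> p (u, 0)) = (\<epsilon> *\<^sub>R u, 0)\<close>.\<close>

lemma \<sigma>_A: "\<sigma> p (A p u) v = \<sigma> p u (A p v)"
  and sharp_\<pi>_flat: "sharp (\<pi> p) (flat (\<sigma> p) u) = \<epsilon> *\<^sub>R u - A p (A p u)"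
proof -
  have *: "\<Phi> p (\<Phi> p (u, 0)) = (\<epsilon> *\<^sub>R u, 0)" by (simp add: \<Phi>_square)
  then have "flat (\<sigma> p) (A p u) = flat (\<sigma> p) u o\<^sub>L A p"
    unfolding \<Phi>_vector \<Phi>_eq by (simp add: sharp_zero)
  then show "\<sigma> p (A p u) v = \<sigma> p u (A p v)" by (simp add: flat_def)
  show "sharp (\<pi> p) (flat (\<sigma> p) u) = \<epsilon> *\<^sub>R u - A p (A p u)"
    using * unfolding \<Phi>_vector \<Phi>_eq by (simp add: sharp_zero algebra_simps)
qed

lemma big_section_\<Phi>:
  assumes "big_section \<A> S"
  shows "big_section \<A> (\<lambda>q. \<Phi> q (S q))"
proof -
  note S = big_sectionD[OF assms]
  have "big_section \<A> (\<lambda>q. (A q (fst (S q)) + sharp (\<pi> q) (snd (S q)),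
      flat (\<sigma> q) (fst (S q)) + (-1) *\<^sub>R (snd (S q) o\<^sub>L A q)))"
    by (intro big_sectionI vector_field_add one_form_add one_form_scaleR vector_field_end
        one_form_end one_form_flat vector_field_sharp S A_field \<pi>_field \<sigma>_form)
  moreover have "\<Phi> q (S q) = (A q (fst (S q)) + sharp (\<pi> q) (snd (S q)),
      flat (\<sigma> q) (fst (S q)) + (-1) *\<^sub>R (snd (S q) o\<^sub>L A q))" for q
    using \<Phi>_eq[of q "fst (S q)" "snd (S q)"] by simp
  ultimately show ?thesis by simp
qed

lemma torsion_add_left:
  assumes "big_section \<A> S" "big_section \<A> S'" "big_section \<A> T"
  shows "torsion \<Phi> (\<lambda>q. S q + S' q) T p = torsion \<Phi> S T p + torsion \<Phi> S' T p"
  using assms by (simp add: torsion_def courant_add_left big_section_\<Phi> blinfun.bilinear_simps)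

lemma torsion_add_right:
  assumes "big_section \<A> S" "big_section \<A> T" "big_section \<A> T'"
  shows "torsion \<Phi> S (\<lambda>q. T q + T' q) p = torsion \<Phi> S T p + torsion \<Phi> S T' p"
  using assms by (simp add: torsion_def courant_add_right big_section_\<Phi> blinfun.bilinear_simps)

text \<open>Applying \<open>\<Phi>\<close> twice inside a bracket gives the constant
  \<open>\<epsilon>\<close>, which can be pulled out; the four terms of the sum are then those of
  \<open>- \<Phi> p\<close> applied to the torsion, in another order.\<close>

lemma torsion_\<Phi>_left:
  assumes "big_section \<A> S" "big_section \<A> T"
  shows "torsion \<Phi> (\<lambda>q. \<Phi> q (S q)) T p = - \<Phi> p (torsion \<Phi> S T p)"
  using assms by (simp add: torsion_def courant_scaleR_left big_section_\<Phi> \<Phi>_square blinfun.bilinear_simps)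

lemma torsion_\<Phi>_right:
  assumes "big_section \<A> S" "big_section \<A> T"
  shows "torsion \<Phi> S (\<lambda>q. \<Phi> q (T q)) p = - \<Phi> p (torsion \<Phi> S T p)"
  using assms by (simp add: torsion_def courant_scaleR_right big_section_\<Phi> \<Phi>_square blinfun.bilinear_simps)

lemma vector_section: "vector_field \<A> X \<Longrightarrow> big_section \<A> (\<lambda>q. (X q, 0))"
  by (rule big_sectionI[OF _ one_form_zero])

lemma torsion_zero_if_vectors:
  assumes w: "bivector_field \<A> w" "\<And>p v. sharp (w p) (flat (\<sigma> p) v) = - v"
    and vec: "\<And>X Y p. vector_field \<A> X \<Longrightarrow> vector_field \<A> Y \<Longrightarrow>
      torsion \<Phi> (\<lambda>q. (X q, 0)) (\<lambda>q. (Y q, 0)) p = 0"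
    and S: "big_section \<A> S" and T: "big_section \<A> T"
  shows "torsion \<Phi> S T p = 0"
proof -
  have split: "\<exists>Z X. vector_field \<A> Z \<and> vector_field \<A> X \<and> S = (\<lambda>q. (Z q, 0) + \<Phi> q (X q, 0))"
    if S: "big_section \<A> S" for S
  proof -
    \<comment> \<open>The form part of \<open>\<Phi> q (X q, 0)\<close> is
      \<open>flat (\<sigma> q) (X q)\<close>. Equating it with the form part of \<open>S\<close>
      forces this \<open>X\<close>, which is smooth because \<open>w\<close> is; \<open>Z\<close>
      collects the remaining vector part.\<close>
    define X where "X q = (-1) *\<^sub>R sharp (w q) (snd (S q))" for q
    define Z where "Z q = fst (S q) + (-1) *\<^sub>R A q (X q)" for q
    have X: "vector_field \<A> X"
      unfolding X_def by (intro vector_field_scaleR vector_field_sharp w big_sectionD S)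
    have Z: "vector_field \<A> Z"
      unfolding Z_def by (intro vector_field_add vector_field_scaleR vector_field_end A_field X big_sectionD S)
    have "flat (\<sigma> q) (X q) = snd (S q)" for q
    proof -
      obtain u where "flat (\<sigma> q) u = snd (S q)" using flat_inverse[OF symp] by metis
      with w(2)[of q u] show ?thesis by (simp add: X_def)
    qed
    then have "S q = (Z q, 0) + \<Phi> q (X q, 0)" for q
      by (simp add: \<Phi>_vector Z_def prod_eq_iff)
    then show ?thesis using X Z by blast
  qed
  obtain Z X where ZX: "vector_field \<A> Z" "vector_field \<A> X" "S = (\<lambda>q. (Z q, 0) + \<Phi> q (X q, 0))"
    using split[OF S] by blast
  obtain Z' X' where ZX': "vector_field \<A> Z'" "vector_field \<A> X'" "T = (\<lambda>q. (Z' q, 0) + \<Phi> q (X' q, 0))"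
    using split[OF T] by blast
  show ?thesis
    unfolding ZX(3) ZX'(3)
    by (simp add: torsion_add_left torsion_add_right torsion_\<Phi>_left torsion_\<Phi>_right
        big_section_add big_section_\<Phi> vector_section ZX(1,2) ZX'(1,2) vec)
qed

end

section \<open>The torsion on vector fields\<close>

context symplectic_cps
begin

lemma dform2_closed: "dform2 \<sigma> p u v w + dform2 \<sigma> p v w u + dform2 \<sigma> p w u v = 0"
  using symp unfolding symplectic_def by (metis ext_deriv2_dform2)

text \<open>The left side is L_X i_Y \<sigma> - L_Y i_X \<sigma> + d(\<sigma>(X, Y)). As d\<sigma> =
  0, Cartan's formula gives L_Y i_X \<sigma> = d(\<sigma>(X, Y)) + i_Y L_X \<sigma>, and what
  remains is the commutator of L_X and i_Y, which is i_[X,Y].\<close>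

lemma cartan:
  assumes X: "vector_field \<A> X" and Y: "vector_field \<A> Y"
  shows "snd (courant \<A> (\<lambda>q. (X q, 0)) (\<lambda>q. \<Phi> q (Y q, 0)) p)
       + snd (courant \<A> (\<lambda>q. \<Phi> q (X q, 0)) (\<lambda>q. (Y q, 0)) p)
       = flat (\<sigma> p) (lie_bracket \<A> X Y p)" (is "?l + ?r = _")
proof (rule blinfun_eqI)
  note sections = vector_section[OF X] vector_section[OF Y]
    big_section_\<Phi>[OF vector_section[OF X]] big_section_\<Phi>[OF vector_section[OF Y]]
  fix v
  have l: "?l v = dform2 \<sigma> p (X p) (Y p) v + \<sigma> p (jac \<A> Y p (X p)) v + \<sigma> p (Y p) (jac \<A> X p v)
      - (dform2 \<sigma> p v (Y p) (X p) + \<sigma> p (jac \<A> Y p v) (X p) + \<sigma> p (Y p) (jac \<A> X p v)) / 2"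
    by (subst courant_snd[OF sections(1,4)])
      (simp add: \<Phi>_vector dform_flat[OF \<sigma>_form Y, unfolded flat_def] dform_zero flat_def blinfun.bilinear_simps field_simps)
  have r: "?r v = - dform2 \<sigma> p (Y p) (X p) v - \<sigma> p (jac \<A> X p (Y p)) v - \<sigma> p (X p) (jac \<A> Y p v)
      + (dform2 \<sigma> p v (X p) (Y p) + \<sigma> p (jac \<A> X p v) (Y p) + \<sigma> p (X p) (jac \<A> Y p v)) / 2"
    by (subst courant_snd[OF sections(3,2)])
      (simp add: \<Phi>_vector dform_flat[OF \<sigma>_form X, unfolded flat_def] dform_zero flat_def blinfun.bilinear_simps field_simps)
  show "(?l + ?r) v = flat (\<sigma> p) (lie_bracket \<A> X Y p) v"
    \<comment> \<open>Closedness removes the derivatives of the 2-form; skewness cancels the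
      Jacobians applied to \<open>v\<close>, leaving the two that form the Lie bracket.\<close>
    using dform2_closed[of p "X p" "Y p" v] dform2_skew[OF \<sigma>_form, of p "Y p" "X p" v]
      dform2_skew[OF \<sigma>_form, of p v "X p" "Y p"]
      \<sigma>_skew[of p "jac \<A> X p v" "Y p"] \<sigma>_skew[of p "jac \<A> Y p v" "X p"]
    by (simp add: l r lie_bracket_def flat_def blinfun.bilinear_simps field_simps)
qed

text \<open>The middle brackets contribute through \<open>\<pi>\<close> only by the sum of their
  form parts. By \<open>cartan\<close> and \<open>sharp_\<pi>_flat\<close> this is \<epsilon>[X,Y] -
  A^2[X,Y]; subtracting it from the last torsion term \<epsilon>[X,Y] leaves the A^2[X,Y] of the
  Nijenhuis tensor.\<close>

lemma torsion_vectors_fst: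
  assumes X: "vector_field \<A> X" and Y: "vector_field \<A> Y"
  shows "fst (torsion \<Phi> (\<lambda>q. (X q, 0)) (\<lambda>q. (Y q, 0)) p) = nijenhuis \<A> A X Y p"
proof -
  let ?c2 = "courant \<A> (\<lambda>q. (X q, 0)) (\<lambda>q. \<Phi> q (Y q, 0)) p"
  let ?c3 = "courant \<A> (\<lambda>q. \<Phi> q (X q, 0)) (\<lambda>q. (Y q, 0)) p"
  have \<Phi>_fst: "fst (\<Phi> p x) = A p (fst x) + sharp (\<pi> p) (snd x)" for x
    using \<Phi>_eq[of p "fst x" "snd x"] by simp
  have "sharp (\<pi> p) (snd ?c2) = \<epsilon> *\<^sub>R lie_bracket \<A> X Y p - A p (A p (lie_bracket \<A> X Y p))
      - sharp (\<pi> p) (snd ?c3)"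
    using arg_cong[OF cartan[OF X Y, of p], of "sharp (\<pi> p)"]
    unfolding sharp_add sharp_\<pi>_flat by (simp add: algebra_simps)
  then show ?thesis
    unfolding torsion_def \<Phi>_square fst_add fst_diff fst_scaleR \<Phi>_fst
    by (simp add: courant_fst \<Phi>_vector nijenhuis_def Let_def lie_bracket_def blinfun.bilinear_simps
        algebra_simps)
qed

text \<open>A common normal form in which no derivatives of \<open>X\<close> and \<open>Y\<close>
  occur: the form part of the torsion and the Schouten concomitant on flat 1-forms are both brought
  to it.\<close>

definition concomitant_form :: "('m, 'e) vfield \<Rightarrow> ('m, 'e) vfield \<Rightarrow> 'm \<Rightarrow> 'e \<Rightarrow> real" where
  "concomitant_form X Y p v = dform2 \<sigma> p (A p v) (X p) (Y p) - dform2 \<sigma> p v (A p (X p)) (Y p)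
     + \<sigma> p (Y p) (dend A p v (X p)) - \<sigma> p (Y p) (dend A p (X p) v) + \<sigma> p (X p) (dend A p (Y p) v)"

lemma torsion_vectors_snd:
  assumes X: "vector_field \<A> X" and Y: "vector_field \<A> Y"
  shows "snd (torsion \<Phi> (\<lambda>q. (X q, 0)) (\<lambda>q. (Y q, 0)) p) v = concomitant_form X Y p v"
proof -
  let ?c1 = "courant \<A> (\<lambda>q. \<Phi> q (X q, 0)) (\<lambda>q. \<Phi> q (Y q, 0)) p"
  let ?c2 = "courant \<A> (\<lambda>q. (X q, 0)) (\<lambda>q. \<Phi> q (Y q, 0)) p"
  let ?c3 = "courant \<A> (\<lambda>q. \<Phi> q (X q, 0)) (\<lambda>q. (Y q, 0)) p"
  let ?c4 = "courant \<A> (\<lambda>q. (X q, 0)) (\<lambda>q. (Y q, 0)) p"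
  let ?s = "\<sigma> p" and ?a = "A p" and ?x = "X p" and ?y = "Y p"
  let ?s' = "dform2 \<sigma> p" and ?a' = "dend A p" and ?X = "jac \<A> X p" and ?Y = "jac \<A> Y p"
  note sections = vector_section[OF X] vector_section[OF Y]
    big_section_\<Phi>[OF vector_section[OF X]] big_section_\<Phi>[OF vector_section[OF Y]]
  have \<Phi>_snd: "snd (\<Phi> p x) u = ?s (fst x) u - snd x (?a u)" for x u
    using \<Phi>_eq[of p "fst x" "snd x"] by (simp add: flat_def blinfun.bilinear_simps)
  have c4: "snd ?c4 = 0"
    by (rule blinfun_eqI) (simp add: courant_snd sections dform_zero)
  have c1: "snd ?c1 v = ?s' (?a ?x) ?y v + ?s (?Y (?a ?x)) v + ?s ?y (?a' v ?x + ?a (?X v))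
      - ?s' (?a ?y) ?x v - ?s (?X (?a ?y)) v - ?s ?x (?a' v ?y + ?a (?Y v))
      + (?s' v ?x (?a ?y) + ?s (?X v) (?a ?y) + ?s ?x (?a' v ?y + ?a (?Y v))
       - ?s' v ?y (?a ?x) - ?s (?Y v) (?a ?x) - ?s ?y (?a' v ?x + ?a (?X v))) / 2"
    by (subst courant_snd[OF sections(3,4)])
      (simp add: \<Phi>_vector dform_flat[OF \<sigma>_form X, unfolded flat_def] dform_flat[OF \<sigma>_form Y, unfolded flat_def] jac_end[OF A_field X]
        jac_end[OF A_field Y] flat_def blinfun.bilinear_simps)
  \<comment> \<open>The form parts of the two middle brackets enter only through their sum, which
    \<open>cartan\<close> evaluates at once.\<close>
  have c23: "snd ?c2 (?a v) + snd ?c3 (?a v) = ?s (?Y ?x - ?X ?y) (?a v)"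
    using arg_cong[OF cartan[OF X Y, of p], of "\<lambda>\<xi>. \<xi> (?a v)"]
    by (simp add: lie_bracket_def flat_def blinfun.bilinear_simps)
  have f2: "fst ?c2 = ?a' ?x ?y + ?a (?Y ?x) - ?X (?a ?y)"
    and f3: "fst ?c3 = ?Y (?a ?x) - (?a' ?y ?x + ?a (?X ?y))"
    by (simp_all add: courant_fst \<Phi>_vector jac_end[OF A_field X] jac_end[OF A_field Y])
  have "snd (torsion \<Phi> (\<lambda>q. (X q, 0)) (\<lambda>q. (Y q, 0)) p) v
      = snd ?c1 v - ?s (fst ?c2 + fst ?c3) v + (snd ?c2 (?a v) + snd ?c3 (?a v))"
    unfolding torsion_def \<Phi>_square by (simp add: c4 \<Phi>_snd blinfun.bilinear_simps)
  also have "\<dots> = concomitant_form X Y p v"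
    unfolding c1 c23 f2 f3 concomitant_form_def
    \<comment> \<open>Closedness is used on the three triples with \<open>A\<close> in one slot. The
      differentiated compatibility trades derivatives of \<open>A\<close> for derivatives of the
      2-form, and \<open>\<sigma>_A\<close> with skewness cancels all Jacobians of \<open>X\<close>
      and \<open>Y\<close>.\<close>
    using dform2_closed[of p "?a ?x" ?y v] dform2_closed[of p "?a ?y" ?x v] dform2_closed[of p "?a v" ?x ?y]
      dform2_compatible[OF \<sigma>_form A_field \<sigma>_A, of p v ?x ?y]
      dform2_compatible[OF \<sigma>_form A_field \<sigma>_A, of p ?x ?y v]
      dform2_compatible[OF \<sigma>_form A_field \<sigma>_A, of p ?y ?x v]
      dform2_skew[OF \<sigma>_form, of p v ?y "?a ?x"] dform2_skew[OF \<sigma>_form, of p v "?a ?y" ?x]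
      dform2_skew[OF \<sigma>_form, of p ?y v "?a ?x"] dform2_skew[OF \<sigma>_form, of p ?x v "?a ?y"]
      dform2_skew[OF \<sigma>_form, of p ?y "?a v" ?x]
      \<sigma>_skew[of p "?a' v ?x" ?y] \<sigma>_skew[of p "?X v" "?a ?y"] \<sigma>_skew[of p "?Y v" "?a ?x"]
      \<sigma>_A[of p "?Y ?x" v] \<sigma>_A[of p "?X ?y" v] \<sigma>_A[of p ?x "?Y v"] \<sigma>_A[of p ?y "?X v"]
    by (simp add: blinfun.bilinear_simps field_simps)
  finally show ?thesis .
qed

text \<open>Flat 1-forms eliminate \<open>w\<close>: \<open>sharp\<close> returns minus the vector,
  the pairing by \<open>w\<close> becomes the 2-form itself, and composition with \<open>A\<close>
  moves inside \<open>flat\<close>. The Jacobians of \<open>X\<close> and \<open>Y\<close> then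
  cancel by skewness and \<open>\<sigma>_A\<close>.\<close>

lemma concomitant_flat:
  assumes w: "\<And>p v. sharp (w p) (flat (\<sigma> p) v) = - v"
    and X: "vector_field \<A> X" and Y: "vector_field \<A> Y"
  shows "schouten_concomitant \<A> w A (\<lambda>q. flat (\<sigma> q) (X q)) (\<lambda>q. flat (\<sigma> q) (Y q)) p v
    = concomitant_form X Y p v"
proof -
  let ?s = "\<sigma> p" and ?a = "A p" and ?x = "X p" and ?y = "Y p"
  let ?s' = "dform2 \<sigma> p" and ?a' = "dend A p" and ?X = "jac \<A> X p" and ?Y = "jac \<A> Y p"
  note AX = vector_field_end[OF A_field X]
  have "w q (flat (\<sigma> q) u) \<beta> = - \<beta> u" for q u \<beta>
    by (simp add: w blinfun.bilinear_simps flip: covector_sharp)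
  then have wf: "w q (flat (\<sigma> q) u) (flat (\<sigma> q) v) = flat (\<sigma> q) u v" for q u v
    using \<sigma>_skew[of q u v] by (simp add: flat_def)
  have fA: "flat (\<sigma> q) u o\<^sub>L A q = flat (\<sigma> q) (A q u)" for q u
    by (rule blinfun_eqI) (simp add: flat_def \<sigma>_A)
  have jac_minus: "jac \<A> (\<lambda>q. - Z q) p u = - jac \<A> Z p u" if "vector_field \<A> Z" for Z u
    using jac_scaleR[OF that, of "-1" p u] by simp
  have dend_minus: "dend A p (- u) = - dend A p u" for u
    using linear_neg[OF has_derivative_linear[OF end_has_derivative[OF A_field, of p]]] .
  have lie: "lie_end \<A> (\<lambda>q. - Z q) A p v
      = - (?a' (Z p) v - jac \<A> Z p (?a v) + ?a (jac \<A> Z p v))" if "vector_field \<A> Z" for Z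
    unfolding lie_end_def dend_def[symmetric]
    by (simp add: jac_minus[OF that] dend_minus blinfun.bilinear_simps)
  have d1: "differential \<A> (\<lambda>q. flat (\<sigma> q) (X q) (Y q)) p u
      = ?s' u ?x ?y + ?s (?X u) ?y + ?s ?x (?Y u)" for u
    by (subst differential_pairing[OF one_form_flat[OF \<sigma>_form X] Y])
      (simp add: dform_flat[OF \<sigma>_form X, unfolded flat_def] blinfun.bilinear_simps flat_def)
  have d2: "differential \<A> (\<lambda>q. flat (\<sigma> q) (A q (X q)) (Y q)) p u
      = ?s' u (?a ?x) ?y + ?s (?a' u ?x + ?a (?X u)) ?y + ?s (?a ?x) (?Y u)" for u
    by (subst differential_pairing[OF one_form_flat[OF \<sigma>_form AX] Y])
      (simp add: dform_flat[OF \<sigma>_form AX, unfolded flat_def] jac_end[OF A_field X] blinfun.bilinear_simps flat_def)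
  show ?thesis
    unfolding schouten_concomitant_def w fA wf concomitant_form_def
    using \<sigma>_skew[of p "?a' v ?x" ?y] \<sigma>_skew[of p "?X (?a v)" ?y] \<sigma>_skew[of p "?a (?X v)" ?y]
      \<sigma>_A[of p ?x "?Y v"]
    by (simp add: lie[OF X] lie[OF Y] d1[unfolded flat_def] d2[unfolded flat_def] blinfun.bilinear_simps flat_def)
qed

section \<open>The equivalence\<close>

lemma integrable_iff_symplectic_nijenhuis:
  "gen_integrable \<A> \<Phi> \<longleftrightarrow> symplectic_nijenhuis \<A> \<sigma> A"
proof
  assume int: "gen_integrable \<A> \<Phi>"
  obtain w where w: "bivector_field \<A> w" "\<And>p v. sharp (w p) (flat (\<sigma> p) v) = - v"
    using inverse_bivector_exists[OF symp] by blast
  obtain r where r: "\<And>p \<xi>. flat (\<sigma> p) (blinfun_apply (r p) \<xi>) = \<xi>"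
    using flat_inverse[OF symp] by metis
  have tor: "torsion \<Phi> (\<lambda>q. (X q, 0)) (\<lambda>q. (Y q, 0)) p = 0"
    if "vector_field \<A> X" "vector_field \<A> Y" for X Y p
    using int that vector_section unfolding gen_integrable_iff_torsion by blast
  have "w p (\<alpha> o\<^sub>L A p) \<beta> = w p \<alpha> (\<beta> o\<^sub>L A p)" for p \<alpha> \<beta>
  proof -
    \<comment> \<open>With \<open>\<alpha>\<close> equal to \<open>flat (\<sigma> p) u\<close>, both
      sides become \<open>- \<beta> (A p u)\<close>.\<close>
    define u where "u = r p \<alpha>"
    have u: "\<alpha> = flat (\<sigma> p) u" by (simp add: u_def r)
    have "\<alpha> o\<^sub>L A p = flat (\<sigma> p) (A p u)"
      unfolding u by (rule blinfun_eqI) (simp add: flat_def \<sigma>_A)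
    then show ?thesis
      by (simp add: u w(2) blinfun.bilinear_simps flip: covector_sharp)
  qed
  moreover have "nijenhuis \<A> A X Y p = 0" if "vector_field \<A> X" "vector_field \<A> Y" for X Y p
    using torsion_vectors_fst[OF that, of p] tor[OF that, of p] by simp
  moreover have "schouten_concomitant \<A> w A \<alpha> \<beta> p = 0" if \<alpha>: "one_form \<A> \<alpha>" and \<beta>: "one_form \<A> \<beta>" for \<alpha> \<beta> p
  proof -
    \<comment> \<open>Presents arbitrary 1-forms as flat images of vector fields, so that
      \<open>concomitant_flat\<close> applies to them. The pointwise inverse \<open>r\<close> gives
      surjectivity of \<open>flat\<close>, and \<open>w\<close> gives smooth preimages.\<close>
    have flat_sharp: "flat (\<sigma> q) ((-1) *\<^sub>R sharp (w q) \<xi>) = \<xi>" for q \<xi>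
      using w(2)[of q "r q \<xi>"] by (simp add: r)
    define X where "X q = (-1) *\<^sub>R sharp (w q) (\<alpha> q)" for q
    define Y where "Y q = (-1) *\<^sub>R sharp (w q) (\<beta> q)" for q
    have XY: "vector_field \<A> X" "vector_field \<A> Y"
      unfolding X_def Y_def by (intro vector_field_scaleR vector_field_sharp w(1) \<alpha> \<beta>)+
    have "\<alpha> = (\<lambda>q. flat (\<sigma> q) (X q))" "\<beta> = (\<lambda>q. flat (\<sigma> q) (Y q))"
      unfolding X_def Y_def flat_sharp by simp_all
    then show ?thesis
      using concomitant_flat[OF w(2) XY, of p] torsion_vectors_snd[OF XY, of p] tor[OF XY, of p]
      by (intro blinfun_eqI) simp
  qed
  ultimately show "symplectic_nijenhuis \<A> \<sigma> A"
    unfolding symplectic_nijenhuis_def poisson_nijenhuis_def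
    using symp w A_field schouten_inverse[OF symp w(2)] by blast
next
  assume "symplectic_nijenhuis \<A> \<sigma> A"
  \<comment> \<open>\<open>concomitant_flat\<close> and \<open>torsion_zero_if_vectors\<close> hold
    for every smooth \<open>w\<close> with this relation, so the bivector field supplied by the
    structure is used directly.\<close>
  then obtain w where pn: "poisson_nijenhuis \<A> w A" and w: "\<And>p v. sharp (w p) (flat (\<sigma> p) v) = - v"
    unfolding symplectic_nijenhuis_def by blast
  have bw: "bivector_field \<A> w" using pn by (simp add: poisson_nijenhuis_def)
  have "torsion \<Phi> (\<lambda>q. (X q, 0)) (\<lambda>q. (Y q, 0)) p = 0"
    if XY: "vector_field \<A> X" "vector_field \<A> Y" for X Y p
  proof (rule prod_eqI)
    have "nijenhuis \<A> A X Y p = 0" using pn XY unfolding poisson_nijenhuis_def by blast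
    then show "fst (torsion \<Phi> (\<lambda>q. (X q, 0)) (\<lambda>q. (Y q, 0)) p) = fst 0"
      by (simp add: torsion_vectors_fst[OF XY])
    have "schouten_concomitant \<A> w A (\<lambda>q. flat (\<sigma> q) (X q)) (\<lambda>q. flat (\<sigma> q) (Y q)) p = 0"
      using pn one_form_flat[OF \<sigma>_form] XY unfolding poisson_nijenhuis_def by blast
    then have "concomitant_form X Y p v = 0" for v
      using concomitant_flat[OF w XY, of p v] by simp
    then show "snd (torsion \<Phi> (\<lambda>q. (X q, 0)) (\<lambda>q. (Y q, 0)) p) = snd 0"
      by (intro blinfun_eqI) (simp add: torsion_vectors_snd[OF XY])
  qed
  then show "gen_integrable \<A> \<Phi>"
    unfolding gen_integrable_iff_torsion using torsion_zero_if_vectors[OF bw w] by blast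
qed

end

theorem proposition1p2:
  fixes \<A> :: "('m::{t2_space,second_countable_topology}, 'e::euclidean_space) chart set"
    and \<epsilon> :: real
    and \<Phi> :: "('m, 'e) bigend"
    and A :: "('m, 'e) endfield"
    and \<pi> :: "('m, 'e) bivfield"
    and \<sigma> :: "('m, 'e) form2"
  assumes "smooth_atlas \<A>"
    and "gen_almost_cps \<A> \<epsilon> \<Phi>"
    and "classical_tensor_fields \<A> \<Phi> A \<pi> \<sigma>"
    and "symplectic \<A> \<sigma>"
  shows "gen_integrable \<A> \<Phi> \<longleftrightarrow> symplectic_nijenhuis \<A> \<sigma> A"
proof -
  interpret symplectic_cps \<A> \<epsilon> \<Phi> A \<pi> \<sigma>
    using assms by unfold_locales
  show ?thesis by (rule integrable_iff_symplectic_nijenhuis)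
qed

end
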